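(* Let $1/4\le\beta<1/3$ and let $G$ be a graph of order $n$ with minimum degree $(1-\beta)n$ (an integer). Then $$\frac{k_s(G)}{g_s(\beta)n^s}\ge\frac{k_t(G)}{g_t(\beta)n^t}$$ for all integers $2\le t<s\le 4$, where $g_2(\beta)=(1-\beta)/2$, $g_3(\beta)=(1-2\beta)^2\beta$, $g_4(\beta)=(1-2\beta)(1-3\beta)\beta^2/2$. Moreover, the following are equivalent: (i) equality holds for some $2\le t<s\le4$; (ii) equality holds for all $2\le t<s\le4$; (iii) $(n,\beta)$ is feasible and $G\in\mathcal{G}(n,\beta)$.
   Context: All graphs are finite and simple; $k_r(G)$ is the number of $r$-cliques of $G$. Here $p=\lceil\beta^{-1}\rceil-1=3$. The family $\mathcal{G}(n,\beta)$ (defined only when $n$ and $(1-\beta)n$ are positive integers not both odd) consists of all graphs $G$ on vertex set $V$, $|V|=n$, admitting a partition $V=V_0\cup V_1\cup\dots\cup V_{p-1}$ with $|V_0|=(1-(p-1)\beta)n$ and $|V_i|=\beta n$ for $1\le i\le p-1$, such that: all edges between $V_i$ and $V_j$ are present for $0\le i<j\le p-1$; $V_i$ is independent for $1\le i\le p-1$; and $G[V_0]$ is $(1-p\beta)n$-regular with minimum number of triangles among all $(1-p\beta)n$-regular graphs on $|V_0|$ vertices. The pair $(n,\beta)$ is feasible if $\mathcal{G}(n,\beta)$ is defined and $G[V_0]$ is triangle-free for $G\in\mathcal{G}(n,\beta)$. *)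

theory Defs
  imports Complex_Main
begin

definition simple_graph :: "'a set \<Rightarrow> 'a set set \<Rightarrow> bool" where
  "simple_graph V E \<longleftrightarrow> finite V \<and> (\<forall>e\<in>E. e \<subseteq> V \<and> card e = 2)"

definition degree :: "'a set \<Rightarrow> 'a set set \<Rightarrow> 'a \<Rightarrow> nat" where
  "degree V E x = card {y\<in>V. {x, y} \<in> E}"

definition min_degree :: "'a set \<Rightarrow> 'a set set \<Rightarrow> nat" where
  "min_degree V E = Min (degree V E ` V)"

definition regular :: "'a set \<Rightarrow> 'a set set \<Rightarrow> nat \<Rightarrow> bool" where
  "regular V E d \<longleftrightarrow> (\<forall>x\<in>V. degree V E x = d)"

definition cliques :: "'a set \<Rightarrow> 'a set set \<Rightarrow> nat \<Rightarrow> 'a set set" where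
  "cliques V E r = {K. K \<subseteq> V \<and> card K = r \<and> (\<forall>x\<in>K. \<forall>y\<in>K. x \<noteq> y \<longrightarrow> {x, y} \<in> E)}"

definition kr :: "'a set \<Rightarrow> 'a set set \<Rightarrow> nat \<Rightarrow> nat" where
  "kr V E r = card (cliques V E r)"

definition induced :: "'a set set \<Rightarrow> 'a set \<Rightarrow> 'a set set" where
  "induced E U = {e\<in>E. e \<subseteq> U}"

definition g_fun :: "nat \<Rightarrow> real \<Rightarrow> real" where
  "g_fun s \<beta> = (if s = 2 then (1 - \<beta>) / 2
     else if s = 3 then (1 - 2*\<beta>)^2 * \<beta>
     else if s = 4 then (1 - 2*\<beta>) * (1 - 3*\<beta>) * \<beta>^2 / 2
     else 0)"

definition family_defined :: "nat \<Rightarrow> real \<Rightarrow> bool" where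
  "family_defined n \<beta> \<longleftrightarrow> n > 0 \<and> (\<exists>m::nat. m > 0 \<and> real m = (1 - \<beta>) * n \<and> \<not> (odd n \<and> odd m))"

definition min_tri_regular :: "'a set \<Rightarrow> 'a set set \<Rightarrow> nat \<Rightarrow> bool" where
  "min_tri_regular U E d \<longleftrightarrow> simple_graph U E \<and> regular U E d \<and>
     (\<forall>E'. simple_graph U E' \<and> regular U E' d \<longrightarrow> kr U E 3 \<le> kr U E' 3)"

definition in_family :: "'a set \<Rightarrow> 'a set set \<Rightarrow> nat \<Rightarrow> real \<Rightarrow> bool" where
  "in_family V E n \<beta> \<longleftrightarrow> family_defined n \<beta> \<and> simple_graph V E \<and> card V = n \<and>
    (\<exists>V0 V1 V2 d. V0 \<union> V1 \<union> V2 = V \<and> V0 \<inter> V1 = {} \<and> V0 \<inter> V2 = {} \<and> V1 \<inter> V2 = {} \<and>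
      real (card V0) = (1 - 2*\<beta>) * n \<and> real (card V1) = \<beta> * n \<and> real (card V2) = \<beta> * n \<and>
      (\<forall>x\<in>V0. \<forall>y\<in>V1. {x, y} \<in> E) \<and> (\<forall>x\<in>V0. \<forall>y\<in>V2. {x, y} \<in> E) \<and>
      (\<forall>x\<in>V1. \<forall>y\<in>V2. {x, y} \<in> E) \<and>
      (\<forall>x\<in>V1. \<forall>y\<in>V1. {x, y} \<notin> E) \<and> (\<forall>x\<in>V2. \<forall>y\<in>V2. {x, y} \<notin> E) \<and>
      real d = (1 - 3*\<beta>) * n \<and> min_tri_regular V0 (induced E V0) d)"

text \<open>Feasibility: \<G>(n,\<beta>) defined and G[V0] triangle-free, i.e. every (1-3\<beta>)n-regular graph on
  (1-2\<beta>)n vertices with minimum number of triangles is triangle-free.\<close>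
definition feasible :: "nat \<Rightarrow> real \<Rightarrow> bool" where
  "feasible n \<beta> \<longleftrightarrow> family_defined n \<beta> \<and>
    (\<forall>(U::nat set) E d. finite U \<and> real (card U) = (1 - 2*\<beta>) * n \<and> real d = (1 - 3*\<beta>) * n \<and>
        min_tri_regular U E d \<longrightarrow> kr U E 3 = 0)"

end

theory Submission
  imports Defs
begin

text \<open>Put \<open>b = \<beta>n\<close> and \<open>r = n - 3b\<close>, so that \<open>0 < r \<le> b\<close>.

  For \<open>k\<^sub>4\<close> against \<open>k\<^sub>3\<close>, sum over the faces \<open>T\<close> of all 4-cliques the number \<open>d(T)\<close> of common
  neighbours of \<open>T\<close>, truncated at \<open>b\<close>. Each 4-clique contributes at least \<open>2(b + r)\<close>, and convexity
  on \<open>r \<le> d(T) \<le> b\<close> bounds the total from above. In the case of equality the graph is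
  \<open>K\<^sub>5\<close>-free and some 4-clique has two faces with exactly \<open>b\<close> common neighbours; these two
  neighbourhoods are the parts \<open>V\<^sub>1\<close> and \<open>V\<^sub>2\<close>.

  For \<open>k\<^sub>3\<close> against \<open>k\<^sub>2\<close>, pass to the complement with a loop at every vertex, where all degrees are
  at most \<open>b\<close>. By Chase's argument, deleting the closed neighbourhood of a suitable vertex of degree
  \<open>d\<close> destroys at most \<open>d\<^sup>3\<close> ordered triangles, so there are at most \<open>3b\<^sup>3 + r\<^sup>3\<close> of them, and
  inclusion-exclusion gives the bound on \<open>k\<^sub>3\<close>. Equality makes the graph regular and bounds the
  codegree of every edge by \<open>2b\<close>; the convexity argument one dimension lower then
  yields equality for \<open>k\<^sub>4\<close> against \<open>k\<^sub>3\<close> as well.\<close>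

section \<open>Triples in a reflexive relation of bounded degree\<close>

definition nbh :: "('a \<Rightarrow> 'a \<Rightarrow> bool) \<Rightarrow> 'a set \<Rightarrow> 'a \<Rightarrow> 'a set" where
  "nbh R A v = {u\<in>A. R v u}"

definition triples :: "('a \<Rightarrow> 'a \<Rightarrow> bool) \<Rightarrow> 'a set \<Rightarrow> ('a \<times> 'a \<times> 'a) set" where
  "triples R A = {(x, y, z). x \<in> A \<and> y \<in> A \<and> z \<in> A \<and> R x y \<and> R y z \<and> R x z}"

lemma nbh_subset: "nbh R A v \<subseteq> A"
  by (auto simp: nbh_def)

lemma finite_nbh: "finite A \<Longrightarrow> finite (nbh R A v)"
  by (simp add: nbh_def)

lemma finite_triples: "finite A \<Longrightarrow> finite (triples R A)"
  by (rule finite_subset[of _ "A \<times> A \<times> A"]) (auto simp: triples_def)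

lemma triples_mono: "B \<subseteq> A \<Longrightarrow> triples R B \<subseteq> triples R A"
  by (auto simp: triples_def)

lemma card_eq_sum_of_bool:
  "finite A \<Longrightarrow> card {x\<in>A. P x} = (\<Sum>x\<in>A. of_bool (P x))"
  by (simp add: Int_def)

lemma card_triples_eq_sum:
  assumes "finite A"
  shows "card {(x, y, z). x \<in> A \<and> y \<in> A \<and> z \<in> A \<and> P x y z}
    = (\<Sum>x\<in>A. \<Sum>y\<in>A. \<Sum>z\<in>A. of_bool (P x y z))"
proof -
  have "{(x, y, z). x \<in> A \<and> y \<in> A \<and> z \<in> A \<and> P x y z}
      = {p \<in> A \<times> A \<times> A. case p of (x, y, z) \<Rightarrow> P x y z}"
    by auto
  moreover have "finite (A \<times> A \<times> A)" using assms by simp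
  ultimately show ?thesis
    by (simp only: card_eq_sum_of_bool)
       (simp add: sum.cartesian_product case_prod_unfold)
qed

text \<open>Adjacent transpositions generate the exchange of the first variable with each other one;
  these exchanges later let every entry of a 4-tuple play the distinguished role.\<close>

lemma sum4_swap12:
  "(\<Sum>v\<in>A. \<Sum>x\<in>A. \<Sum>y\<in>A. \<Sum>z\<in>A. f v x y z) = (\<Sum>v\<in>A. \<Sum>x\<in>A. \<Sum>y\<in>A. \<Sum>z\<in>A. f x v y z)"
  by (rule sum.swap)

lemma sum4_swap23:
  "(\<Sum>v\<in>A. \<Sum>x\<in>A. \<Sum>y\<in>A. \<Sum>z\<in>A. f v x y z) = (\<Sum>v\<in>A. \<Sum>x\<in>A. \<Sum>y\<in>A. \<Sum>z\<in>A. f v y x z)"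
  by (rule sum.cong[OF refl], rule sum.swap)

lemma sum4_swap34:
  "(\<Sum>v\<in>A. \<Sum>x\<in>A. \<Sum>y\<in>A. \<Sum>z\<in>A. f v x y z) = (\<Sum>v\<in>A. \<Sum>x\<in>A. \<Sum>y\<in>A. \<Sum>z\<in>A. f v x z y)"
  by (rule sum.cong[OF refl], rule sum.cong[OF refl], rule sum.swap)

lemma sum4_swap13:
  "(\<Sum>v\<in>A. \<Sum>x\<in>A. \<Sum>y\<in>A. \<Sum>z\<in>A. f v x y z) = (\<Sum>v\<in>A. \<Sum>x\<in>A. \<Sum>y\<in>A. \<Sum>z\<in>A. f y x v z)"
proof -
  have "(\<Sum>v\<in>A. \<Sum>x\<in>A. \<Sum>y\<in>A. \<Sum>z\<in>A. f v x y z) = (\<Sum>v\<in>A. \<Sum>x\<in>A. \<Sum>y\<in>A. \<Sum>z\<in>A. f x v y z)"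
    by (rule sum4_swap12)
  also have "\<dots> = (\<Sum>v\<in>A. \<Sum>x\<in>A. \<Sum>y\<in>A. \<Sum>z\<in>A. f y v x z)"
    by (rule sum4_swap23)
  also have "\<dots> = (\<Sum>v\<in>A. \<Sum>x\<in>A. \<Sum>y\<in>A. \<Sum>z\<in>A. f y x v z)"
    by (rule sum4_swap12)
  finally show ?thesis .
qed

lemma sum4_swap14:
  "(\<Sum>v\<in>A. \<Sum>x\<in>A. \<Sum>y\<in>A. \<Sum>z\<in>A. f v x y z) = (\<Sum>v\<in>A. \<Sum>x\<in>A. \<Sum>y\<in>A. \<Sum>z\<in>A. f z x y v)"
proof -
  have "(\<Sum>v\<in>A. \<Sum>x\<in>A. \<Sum>y\<in>A. \<Sum>z\<in>A. f v x y z) = (\<Sum>v\<in>A. \<Sum>x\<in>A. \<Sum>y\<in>A. \<Sum>z\<in>A. f y x v z)"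
    by (rule sum4_swap13)
  also have "\<dots> = (\<Sum>v\<in>A. \<Sum>x\<in>A. \<Sum>y\<in>A. \<Sum>z\<in>A. f z x v y)"
    by (rule sum4_swap34)
  also have "\<dots> = (\<Sum>v\<in>A. \<Sum>x\<in>A. \<Sum>y\<in>A. \<Sum>z\<in>A. f z x y v)"
    by (rule sum4_swap13)
  finally show ?thesis .
qed

lemma sum_card_nbh_cubed:
  assumes "finite A"
  shows "(\<Sum>v\<in>A. (card (nbh R A v))^3)
    = (\<Sum>v\<in>A. \<Sum>x\<in>A. \<Sum>y\<in>A. \<Sum>z\<in>A. of_bool (R v x \<and> R v y \<and> R v z))"
proof (rule sum.cong[OF refl])
  fix v assume "v \<in> A"
  have "(card (nbh R A v))^3 = (\<Sum>x\<in>A. of_bool (R v x)) * ((\<Sum>y\<in>A. of_bool (R v y)) * (\<Sum>z\<in>A. of_bool (R v z)))"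
    unfolding nbh_def card_eq_sum_of_bool[OF assms] by (simp only: power3_eq_cube mult.assoc)
  also have "\<dots> = (\<Sum>x\<in>A. \<Sum>y\<in>A. \<Sum>z\<in>A. of_bool (R v x \<and> R v y \<and> R v z))"
    unfolding sum_product by (simp only: sum_distrib_left of_bool_conj)
  finally show "(card (nbh R A v))^3 = (\<Sum>x\<in>A. \<Sum>y\<in>A. \<Sum>z\<in>A. of_bool (R v x \<and> R v y \<and> R v z))" .
qed

text \<open>Chase's counting lemma. Both sides count 4-tuples with a distinguished entry: on the left
  the other three are pairwise related and the distinguished one is related to at least one of
  them, on the right it is related to all others. In every graph on four labelled points the
  former choices are at most as numerous as the latter.\<close>
lemma sum_touching_le:
  assumes A: "finite A" and sym: "\<And>x y. R x y \<Longrightarrow> R y x"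
  shows "(\<Sum>v\<in>A. card (triples R A) - card (triples R (A - nbh R A v))) \<le> (\<Sum>v\<in>A. (card (nbh R A v))^3)"
proof -
  define L where "L v x y z = (of_bool (R x y \<and> R y z \<and> R x z \<and> (R v x \<or> R v y \<or> R v z)) :: nat)" for v x y z
  define P where "P v x y z = (of_bool (R v x \<and> R v y \<and> R v z) :: nat)" for v x y z
  define Q where "Q f = (\<Sum>v\<in>A. \<Sum>x\<in>A. \<Sum>y\<in>A. \<Sum>z\<in>A. f v x y z)" for f :: "'a \<Rightarrow> 'a \<Rightarrow> 'a \<Rightarrow> 'a \<Rightarrow> nat"
  \<comment> \<open>Deleting points only removes triples, so the subtraction is not truncated: it
    counts the triples with an entry related to \<open>v\<close>.\<close>
  have touch: "card (triples R A) - card (triples R (A - nbh R A v)) = (\<Sum>x\<in>A. \<Sum>y\<in>A. \<Sum>z\<in>A. L v x y z)" for v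
  proof -
    have "card (triples R A) - card (triples R (A - nbh R A v)) = card (triples R A - triples R (A - nbh R A v))"
      by (rule card_Diff_subset[symmetric]) (simp_all add: finite_triples A triples_mono)
    also have "triples R A - triples R (A - nbh R A v)
        = {(x, y, z). x \<in> A \<and> y \<in> A \<and> z \<in> A \<and> (R x y \<and> R y z \<and> R x z \<and> (R v x \<or> R v y \<or> R v z))}"
      by (auto simp: triples_def nbh_def)
    finally show ?thesis unfolding L_def card_triples_eq_sum[OF A] .
  qed
  have sw: "Q (\<lambda>v x y z. f x v y z) = Q f" "Q (\<lambda>v x y z. f y x v z) = Q f" "Q (\<lambda>v x y z. f z x y v) = Q f" for f
    unfolding Q_def by (rule sum4_swap12[symmetric], rule sum4_swap13[symmetric], rule sum4_swap14[symmetric])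
  have symmetrize: "4 * Q f = Q (\<lambda>v x y z. f v x y z + f x v y z + f y x v z + f z x y v)" for f
  proof -
    have "Q (\<lambda>v x y z. f v x y z + f x v y z + f y x v z + f z x y v)
       = Q f + Q (\<lambda>v x y z. f x v y z) + Q (\<lambda>v x y z. f y x v z) + Q (\<lambda>v x y z. f z x y v)"
      by (simp add: Q_def sum.distrib)
    also have "\<dots> = 4 * Q f" unfolding sw(1)[of f] sw(2)[of f] sw(3)[of f] by simp
    finally show ?thesis ..
  qed
  have pointwise: "L v x y z + L x v y z + L y x v z + L z x y v
      \<le> P v x y z + P x v y z + P y x v z + P z x y v" for v x y z
  proof -
    have s: "R x v = R v x" "R y v = R v y" "R z v = R v z" "R y x = R x y" "R z x = R x z" "R z y = R y z"
      using sym by blast+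
    show ?thesis unfolding L_def P_def s
      by (cases "R v x"; cases "R v y"; cases "R v z"; cases "R x y"; cases "R x z"; cases "R y z"; simp)
  qed
  have "4 * Q L \<le> 4 * Q P"
    unfolding symmetrize[of L] symmetrize[of P] unfolding Q_def by (intro sum_mono pointwise)
  then show ?thesis
    by (simp add: touch sum_card_nbh_cubed[OF A] Q_def P_def)
qed

section \<open>Sums of cubes of class sizes at most b\<close>

text \<open>The number of ordered triples in a disjoint union of complete classes with loops:
  \<open>m div b\<close> of size \<open>b\<close> and one of size \<open>m mod b\<close>. This is
  the extremal configuration.\<close>

definition cube_bound :: "nat \<Rightarrow> nat \<Rightarrow> nat" where
  "cube_bound b m = (m div b) * b^3 + (m mod b)^3"

text \<open>The value \<open>r = b\<close> is allowed, since a full last block gives the same sum.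
  It occurs exactly at \<beta> = 1/4.\<close>

lemma cube_bound_add:
  assumes "r \<le> b" "b > 0"
  shows "cube_bound b (q * b + r) = q * b^3 + r^3"
proof (cases "r = b")
  case True
  have "(q * b + b) div b = q + 1" using assms by simp
  then show ?thesis unfolding cube_bound_def True using assms by simp
qed (use assms in \<open>simp add: cube_bound_def\<close>)

lemma cube_bound_decompose:
  assumes "b > 0"
  obtains q r where "m = q * b + r" "r < b" "cube_bound b m = q * b^3 + r^3"
  by (rule that[of "m div b" "m mod b"]) (use assms in \<open>auto simp: cube_bound_def\<close>)

lemma cubes_sum_le:
  fixes x y :: nat
  shows "x^3 + y^3 \<le> (x + y)^3"
proof -
  have "(x + y)^3 = x^3 + y^3 + 3 * x^2 * y + 3 * x * y^2"
    by (simp add: power3_eq_cube power2_eq_square algebra_simps)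
  then show ?thesis by simp
qed

lemma cubes_sum_less:
  fixes x y :: nat
  assumes "x > 0" "y > 0"
  shows "x^3 + y^3 < (x + y)^3"
proof -
  have "(x + y)^3 = x^3 + y^3 + 3 * x^2 * y + 3 * x * y^2"
    by (simp add: power3_eq_cube power2_eq_square algebra_simps)
  then show ?thesis using assms by simp
qed

text \<open>Convexity at fixed sum \<open>b + r\<close>: with \<open>s = d - r\<close> and
  \<open>t = b - d\<close> the gap is \<open>3 * s * t * (b + r)\<close>.\<close>

lemma cubes_spread_le:
  fixes d r b :: nat
  assumes "r \<le> d" "d \<le> b"
  shows "d^3 + (b + r - d)^3 \<le> b^3 + r^3"
proof -
  obtain s where s: "d = r + s" using assms(1) le_Suc_ex by blast
  obtain t where t: "b = r + s + t" using assms(2) s le_Suc_ex by blast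
  have "b + r - d = r + t" using s t by simp
  moreover have "b^3 + r^3 = (r + s)^3 + (r + t)^3 + (6 * r * s * t + 3 * s * t * (s + t))"
    unfolding t by (simp add: power3_eq_cube algebra_simps)
  ultimately show ?thesis unfolding s by simp
qed

text \<open>If \<open>d\<close> fits into the remainder, superadditivity of cubes suffices.
  Otherwise a full block is broken up, and convexity compares the sizes \<open>d\<close>,
  \<open>b + r - d\<close> with \<open>b\<close>, \<open>r\<close>.\<close>

lemma cube_bound_step:
  assumes "d \<le> b" "d \<le> m" "b > 0"
  shows "d^3 + cube_bound b (m - d) \<le> cube_bound b m"
proof -
  obtain q r where m: "m = q * b + r" and r: "r < b" and f: "cube_bound b m = q * b^3 + r^3"
    using cube_bound_decompose[OF assms(3)] .
  show ?thesis
  proof (cases "d \<le> r")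
    case True
    then have "m - d = q * b + (r - d)" by (simp add: m)
    then have "cube_bound b (m - d) = q * b^3 + (r - d)^3"
      using cube_bound_add[of "r - d" b q] r assms(3) by simp
    then show ?thesis using cubes_sum_le[of d "r - d"] True f by simp
  next
    case False
    then obtain q' where q': "q = Suc q'"
      using assms(2) m by (cases q) auto
    have le: "b + r - d \<le> b" using False by simp
    have "m - d = q' * b + (b + r - d)" using q' assms(1) by (simp add: m)
    then have "cube_bound b (m - d) = q' * b^3 + (b + r - d)^3"
      using cube_bound_add[OF le assms(3), of q'] by simp
    then show ?thesis using cubes_spread_le[of r d b] False assms(1) f q' by simp
  qed
qed

text \<open>Splitting the remainder into two nonempty pieces would lose strictly, by strict
  superadditivity of cubes.\<close>

lemma cube_bound_step_eqD:
  assumes "d^3 + cube_bound b (q * b + r - d) = cube_bound b (q * b + r)"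
    and "0 < d" "r \<le> b" "b > 0"
  shows "r \<le> d"
proof (rule ccontr)
  assume "\<not> r \<le> d"
  then have d: "d < r" by simp
  then have "q * b + r - d = q * b + (r - d)" by simp
  then have "cube_bound b (q * b + r - d) = q * b^3 + (r - d)^3"
    using cube_bound_add[of "r - d" b q] assms(3,4) by simp
  moreover have "cube_bound b (q * b + r) = q * b^3 + r^3"
    using cube_bound_add[of r b q] assms(3,4) by simp
  ultimately show False using assms(1) cubes_sum_less[of d "r - d"] assms(2) d by simp
qed

section \<open>The bound on the number of triples and its extremal case\<close>

text \<open>By averaging, some neighbourhood touches at most as many triples as the cube of its
  size. Remove it and induct, with \<open>cube_bound_step\<close> as the arithmetic.\<close>

lemma card_triples_le:
  assumes "finite A" and "\<And>x. R x x" and "\<And>x y. R x y \<Longrightarrow> R y x"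
    and "\<And>v. v \<in> A \<Longrightarrow> card (nbh R A v) \<le> b" and "b > 0"
  shows "card (triples R A) \<le> cube_bound b (card A)"
  using assms(1,4)
proof (induction "card A" arbitrary: A rule: less_induct)
  case less
  show ?case
  proof (cases "A = {}")
    case True
    then have "triples R A = {}" by (simp add: triples_def)
    then show ?thesis by simp
  next
    case False
    have "\<exists>v\<in>A. card (triples R A) - card (triples R (A - nbh R A v)) \<le> (card (nbh R A v))^3"
    proof (rule ccontr)
      assume "\<not> ?thesis"
      then have "(\<Sum>v\<in>A. (card (nbh R A v))^3) < (\<Sum>v\<in>A. card (triples R A) - card (triples R (A - nbh R A v)))"
        using False less.prems(1) by (intro sum_strict_mono) auto
      then show False using sum_touching_le[OF less.prems(1), of R] assms(3) by fastforce
    qed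
    then obtain v where v: "v \<in> A"
      and touch: "card (triples R A) - card (triples R (A - nbh R A v)) \<le> (card (nbh R A v))^3" by blast
    let ?N = "nbh R A v"
    have vN: "v \<in> ?N" using v assms(2) by (simp add: nbh_def)
    have card: "card (A - ?N) = card A - card ?N"
      by (intro card_Diff_subset finite_nbh less.prems(1) nbh_subset)
    have "card (A - ?N) < card A"
      using v vN less.prems(1) by (intro psubset_card_mono) auto
    moreover have "card (nbh R (A - ?N) u) \<le> b" if "u \<in> A - ?N" for u
    proof -
      have "card (nbh R (A - ?N) u) \<le> card (nbh R A u)"
        by (intro card_mono finite_nbh less.prems(1)) (auto simp: nbh_def)
      then show ?thesis using less.prems(2)[of u] that by simp
    qed
    ultimately have "card (triples R (A - ?N)) \<le> cube_bound b (card A - card ?N)"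
      using less.hyps[of "A - ?N"] less.prems(1) card by simp
    moreover have "(card ?N)^3 + cube_bound b (card A - card ?N) \<le> cube_bound b (card A)"
      by (intro cube_bound_step less.prems(2) v assms(5) card_mono less.prems(1) nbh_subset)
    ultimately show ?thesis using touch by simp
  qed
qed

text \<open>The bound for the remainder makes every vertex touch at least the cube of its degree
  many triples, while the sum over all vertices is at most the sum of these cubes. Hence every
  vertex, not just a suitable one, gives a tight deletion step.\<close>

lemma card_triples_extremal:
  assumes "finite A" and "\<And>x. R x x" and "\<And>x y. R x y \<Longrightarrow> R y x"
    and deg: "\<And>v. v \<in> A \<Longrightarrow> card (nbh R A v) \<le> b" and "b > 0"
    and eq: "card (triples R A) = cube_bound b (card A)" and u: "u \<in> A"
  shows "card (triples R (A - nbh R A u)) = cube_bound b (card A - card (nbh R A u))"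
    and "(card (nbh R A u))^3 + cube_bound b (card A - card (nbh R A u)) = cube_bound b (card A)"
proof -
  let ?N = "nbh R A"
  define \<tau> where "\<tau> v = card (triples R A) - card (triples R (A - ?N v))" for v
  have rest: "card (triples R (A - ?N v)) \<le> cube_bound b (card A - card (?N v))" if "v \<in> A" for v
  proof -
    have "card (nbh R (A - ?N v) w) \<le> b" if "w \<in> A - ?N v" for w
    proof -
      have "card (nbh R (A - ?N v) w) \<le> card (nbh R A w)"
        by (intro card_mono finite_nbh assms(1)) (auto simp: nbh_def)
      then show ?thesis using deg[of w] that by simp
    qed
    then have "card (triples R (A - ?N v)) \<le> cube_bound b (card (A - ?N v))"
      using assms(1,2,3,5) by (intro card_triples_le) auto
    then show ?thesis
      by (simp add: card_Diff_subset[OF finite_nbh nbh_subset] assms(1))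
  qed
  have step: "(card (?N v))^3 + cube_bound b (card A - card (?N v)) \<le> cube_bound b (card A)" if "v \<in> A" for v
    using that by (intro cube_bound_step deg assms(5) card_mono assms(1) nbh_subset)
  have lb: "(card (?N v))^3 \<le> \<tau> v" if "v \<in> A" for v
    using rest[OF that] step[OF that] eq by (simp add: \<tau>_def)
  have le: "(\<Sum>v\<in>A. \<tau> v) \<le> (\<Sum>v\<in>A. (card (?N v))^3)"
    unfolding \<tau>_def using assms(1,3) by (rule sum_touching_le)
  have "\<tau> u = (card (?N u))^3"
  proof (rule ccontr)
    assume "\<tau> u \<noteq> (card (?N u))^3"
    then have "(card (?N u))^3 < \<tau> u" using lb[OF u] by simp
    then have "(\<Sum>v\<in>A. (card (?N v))^3) < (\<Sum>v\<in>A. \<tau> v)"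
      using u lb assms(1) by (intro sum_strict_mono_ex1) auto
    then show False using le by simp
  qed
  moreover have "card (triples R (A - ?N u)) \<le> card (triples R A)"
    by (intro card_mono finite_triples assms(1) triples_mono) auto
  ultimately have "card (triples R A) = (card (?N u))^3 + card (triples R (A - ?N u))"
    by (simp add: \<tau>_def)
  then show "card (triples R (A - ?N u)) = cube_bound b (card A - card (?N u))"
    and "(card (?N u))^3 + cube_bound b (card A - card (?N u)) = cube_bound b (card A)"
    using rest[OF u] step[OF u] eq by linarith+
qed

section \<open>Double counting of cliques\<close>

definition common_nbrs :: "'a set \<Rightarrow> 'a set set \<Rightarrow> 'a set \<Rightarrow> 'a set" where
  "common_nbrs V E S = {v\<in>V. \<forall>x\<in>S. {v, x} \<in> E}"

definition codeg :: "'a set \<Rightarrow> 'a set set \<Rightarrow> 'a set \<Rightarrow> nat" where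
  "codeg V E S = card (common_nbrs V E S)"

lemma finite_cliques: "finite V \<Longrightarrow> finite (cliques V E r)"
  by (rule finite_subset[of _ "Pow V"]) (auto simp: cliques_def)

lemma cliques_1: "cliques V E 1 = (\<lambda>x. {x}) ` V"
  by (auto simp: cliques_def card_1_singleton_iff)

lemma cliques_0: "finite V \<Longrightarrow> cliques V E 0 = {{}}"
  by (auto simp: cliques_def dest: finite_subset)

lemma kr_0: "finite V \<Longrightarrow> kr V E 0 = 1"
  by (simp add: kr_def cliques_0)

lemma kr_1: "kr V E 1 = card V"
  unfolding kr_def cliques_1 by (rule card_image) simp

lemma simple_graph_loopless: "simple_graph V E \<Longrightarrow> {x, x} \<notin> E"
  by (force simp: simple_graph_def)

lemma simple_graph_edge: "simple_graph V E \<Longrightarrow> {x, y} \<in> E \<Longrightarrow> x \<in> V \<and> y \<in> V \<and> x \<noteq> y"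
  by (force simp: simple_graph_def)

lemma cliques_induced: "cliques U (induced E U) k = cliques U E k"
  by (auto simp: cliques_def induced_def)

lemma kr_induced: "kr U (induced E U) k = kr U E k"
  by (simp add: kr_def cliques_induced)

lemma degree_induced: "x \<in> U \<Longrightarrow> degree U (induced E U) x = card {y\<in>U. {x, y} \<in> E}"
  unfolding degree_def induced_def by (rule arg_cong[of _ _ card]) auto

lemma simple_graph_induced: "simple_graph V E \<Longrightarrow> U \<subseteq> V \<Longrightarrow> simple_graph U (induced E U)"
  by (auto simp: simple_graph_def induced_def dest: finite_subset)

locale sgraph =
  fixes V :: "'a set" and E :: "'a set set"
  assumes simple: "simple_graph V E"
begin

lemma finite_V: "finite V"
  using simple by (simp add: simple_graph_def)

lemma finite_common_nbrs: "finite (common_nbrs V E S)"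
  using finite_V by (simp add: common_nbrs_def)

lemma cliqueD:
  assumes "S \<in> cliques V E r"
  shows "finite S" "card S = r" "S \<subseteq> V" "x \<in> S \<Longrightarrow> y \<in> S \<Longrightarrow> x \<noteq> y \<Longrightarrow> {x, y} \<in> E"
  using assms finite_V by (auto simp: cliques_def dest: finite_subset)

lemma common_nbrs_disjoint: "v \<in> common_nbrs V E S \<Longrightarrow> v \<notin> S"
  using simple_graph_loopless[OF simple] by (auto simp: common_nbrs_def)

lemma insert_clique:
  assumes "T \<in> cliques V E r" "v \<in> common_nbrs V E T"
  shows "insert v T \<in> cliques V E (Suc r)"
proof -
  have "card (insert v T) = Suc r"
    using common_nbrs_disjoint[OF assms(2)] cliqueD(1,2)[OF assms(1)] by simp
  then show ?thesis
    using assms by (auto simp: cliques_def common_nbrs_def insert_commute)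
qed

lemma remove_clique:
  assumes "S \<in> cliques V E (Suc r)" "x \<in> S"
  shows "S - {x} \<in> cliques V E r" "x \<in> common_nbrs V E (S - {x})"
  using assms cliqueD(1)[OF assms(1)] by (auto simp: cliques_def common_nbrs_def)

text \<open>Both sides run over the same flags: a clique with a chosen vertex, or the opposite face
  with a vertex completing it.\<close>

lemma sum_clique_faces:
  fixes F :: "'a set \<Rightarrow> 'a \<Rightarrow> 'b::comm_monoid_add"
  shows "(\<Sum>S\<in>cliques V E (Suc r). \<Sum>x\<in>S. F (S - {x}) x)
    = (\<Sum>T\<in>cliques V E r. \<Sum>v\<in>common_nbrs V E T. F T v)"
proof -
  have "(\<Sum>S\<in>cliques V E (Suc r). \<Sum>x\<in>S. F (S - {x}) x)
      = (\<Sum>(S, x)\<in>(SIGMA S:cliques V E (Suc r). S). F (S - {x}) x)"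
    by (rule sum.Sigma) (auto simp: finite_cliques finite_V dest: cliqueD)
  also have "\<dots> = (\<Sum>(T, v)\<in>(SIGMA T:cliques V E r. common_nbrs V E T). F T v)"
    by (rule sum.reindex_bij_witness[of _ "\<lambda>(T, v). (insert v T, v)" "\<lambda>(S, x). (S - {x}, x)"])
       (auto simp: insert_clique remove_clique dest: common_nbrs_disjoint)
  also have "\<dots> = (\<Sum>T\<in>cliques V E r. \<Sum>v\<in>common_nbrs V E T. F T v)"
    by (rule sum.Sigma[symmetric]) (auto simp: finite_cliques finite_V finite_common_nbrs)
  finally show ?thesis .
qed

lemma sum_clique_weights:
  fixes w :: "'a set \<Rightarrow> 'b::comm_semiring_1"
  shows "(\<Sum>S\<in>cliques V E (Suc r). \<Sum>x\<in>S. w (S - {x})) = (\<Sum>T\<in>cliques V E r. of_nat (codeg V E T) * w T)"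
  by (simp add: sum_clique_faces[of "\<lambda>T v. w T"] codeg_def)

lemma sum_codeg: "(\<Sum>T\<in>cliques V E r. codeg V E T) = Suc r * kr V E (Suc r)"
  using sum_clique_weights[of "\<lambda>_. 1::nat" r] by (simp add: cliqueD(2) kr_def algebra_simps)

lemma degree_eq_codeg: "degree V E x = codeg V E {x}"
  by (simp add: degree_def codeg_def common_nbrs_def insert_commute)

lemma sum_degree: "(\<Sum>x\<in>V. degree V E x) = 2 * kr V E 2"
  using sum_codeg[of 1] unfolding cliques_1
  by (simp add: sum.reindex degree_eq_codeg numeral_2_eq_2)

text \<open>Each edge arises from two ordered pairs, and the diagonal contributes nothing because
  there are no loops.\<close>

lemma sum_edges:
  fixes w :: "'a set \<Rightarrow> 'b::comm_semiring_1"
  shows "2 * (\<Sum>e\<in>cliques V E 2. w e) = (\<Sum>x\<in>V. \<Sum>y\<in>V. of_bool ({x, y} \<in> E) * w {x, y})"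
proof -
  \<comment> \<open>\<open>w e\<close> is rewritten through the face \<open>e - {x}\<close> to fit
    \<open>sum_clique_faces\<close>.\<close>
  have "2 * (\<Sum>e\<in>cliques V E 2. w e) = (\<Sum>e\<in>cliques V E 2. \<Sum>x\<in>e. w (insert x (e - {x})))"
    unfolding sum_distrib_left
  proof (rule sum.cong[OF refl])
    fix e assume e: "e \<in> cliques V E 2"
    have "(\<Sum>x\<in>e. w (insert x (e - {x}))) = (\<Sum>x\<in>e. w e)"
      by (rule sum.cong) (auto simp: insert_absorb)
    then show "2 * w e = (\<Sum>x\<in>e. w (insert x (e - {x})))"
      using cliqueD(2)[OF e] by simp
  qed
  also have "\<dots> = (\<Sum>T\<in>cliques V E 1. \<Sum>v\<in>common_nbrs V E T. w (insert v T))"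
    using sum_clique_faces[of "\<lambda>T v. w (insert v T)" 1] by (simp add: numeral_2_eq_2)
  also have "\<dots> = (\<Sum>x\<in>V. \<Sum>v\<in>common_nbrs V E {x}. w {v, x})"
    unfolding cliques_1 by (simp add: sum.reindex)
  also have "\<dots> = (\<Sum>x\<in>V. \<Sum>y\<in>V. of_bool ({x, y} \<in> E) * w {x, y})"
  proof (rule sum.cong[OF refl])
    fix x
    have "(\<Sum>v\<in>common_nbrs V E {x}. w {v, x}) = (\<Sum>y\<in>V. if {x, y} \<in> E then w {x, y} else 0)"
      by (rule sum.mono_neutral_cong_left)
         (use finite_V in \<open>auto simp: common_nbrs_def insert_commute\<close>)
    then show "(\<Sum>v\<in>common_nbrs V E {x}. w {v, x}) = (\<Sum>y\<in>V. of_bool ({x, y} \<in> E) * w {x, y})"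
      by (simp add: of_bool_def if_distrib[where f = "\<lambda>c. c * _"] cong: if_cong)
  qed
  finally show ?thesis .
qed

lemma kr_3_ordered:
  "6 * kr V E 3 = (\<Sum>x\<in>V. \<Sum>y\<in>V. \<Sum>z\<in>V. of_bool ({x, y} \<in> E \<and> {y, z} \<in> E \<and> {x, z} \<in> E))"
proof -
  have "6 * kr V E 3 = 2 * (\<Sum>e\<in>cliques V E 2. codeg V E e)"
    using sum_codeg[of 2] by (simp add: numeral_3_eq_3 numeral_2_eq_2)
  also have "\<dots> = (\<Sum>x\<in>V. \<Sum>y\<in>V. of_bool ({x, y} \<in> E) * codeg V E {x, y})"
    using sum_edges[of "codeg V E"] by simp
  also have "\<dots> = (\<Sum>x\<in>V. \<Sum>y\<in>V. \<Sum>z\<in>V. of_bool ({x, y} \<in> E \<and> {y, z} \<in> E \<and> {x, z} \<in> E))"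
  proof (intro sum.cong refl)
    fix x y
    have "codeg V E {x, y} = (\<Sum>z\<in>V. of_bool ({y, z} \<in> E \<and> {x, z} \<in> E))"
      unfolding codeg_def common_nbrs_def card_eq_sum_of_bool[OF finite_V]
      by (rule sum.cong) (auto simp: insert_commute)
    then show "of_bool ({x, y} \<in> E) * codeg V E {x, y}
        = (\<Sum>z\<in>V. of_bool ({x, y} \<in> E \<and> {y, z} \<in> E \<and> {x, z} \<in> E))"
      by (simp only: sum_distrib_left of_bool_conj)
  qed
  finally show ?thesis .
qed

section \<open>The complement with loops and inclusion-exclusion\<close>

definition nonadj :: "'a \<Rightarrow> 'a \<Rightarrow> bool" where
  "nonadj x y \<longleftrightarrow> {x, y} \<notin> E"

lemma nonadj_refl: "nonadj x x"
  using simple_graph_loopless[OF simple] by (simp add: nonadj_def)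

lemma nonadj_sym: "nonadj x y \<Longrightarrow> nonadj y x"
  by (simp add: nonadj_def insert_commute)

abbreviation "nd v \<equiv> card (nbh nonadj V v)"

lemma degree_plus_nd: "degree V E v + nd v = card V"
proof -
  have "degree V E v + nd v = card ({y\<in>V. {v, y} \<in> E} \<union> nbh nonadj V v)"
    unfolding degree_def by (rule card_Un_disjoint[symmetric]) (use finite_V in \<open>auto simp: nbh_def nonadj_def\<close>)
  also have "{y\<in>V. {v, y} \<in> E} \<union> nbh nonadj V v = V"
    by (auto simp: nbh_def nonadj_def)
  finally show ?thesis .
qed

lemma edge_count: "2 * kr V E 2 + (\<Sum>v\<in>V. nd v) = (card V)^2"
  using sum.distrib[of "degree V E" nd V] by (simp add: degree_plus_nd sum_degree power2_eq_square)

text \<open>Inclusion-exclusion over the three pairs of an ordered triple. Two non-edges share a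
  vertex, whence the squares; triples with a repeated vertex drop out because \<open>nonadj\<close>
  is reflexive.\<close>

lemma triangle_count:
  "int (6 * kr V E 3) = int (card V)^3 - 3 * int (card V) * (\<Sum>v\<in>V. int (nd v)) + 3 * (\<Sum>v\<in>V. int (nd v)^2)
    - int (card (triples nonadj V))"
proof -
  define a where "a x y = (of_bool (nonadj x y) :: int)" for x y
  have nd: "(\<Sum>y\<in>V. a x y) = int (nd x)" for x
    unfolding nbh_def card_eq_sum_of_bool[OF finite_V] a_def by simp
  have "int (6 * kr V E 3) = (\<Sum>x\<in>V. \<Sum>y\<in>V. \<Sum>z\<in>V. of_bool (\<not> nonadj x y \<and> \<not> nonadj y z \<and> \<not> nonadj x z))"
    unfolding kr_3_ordered by (simp add: nonadj_def)
  \<comment> \<open>Expansion of \<open>(1 - a x y) * (1 - a y z) * (1 - a x z)\<close>, with the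
    shared vertex written first in each product of two factors so that it sums to a square.\<close>
  also have "\<dots> = (\<Sum>x\<in>V. \<Sum>y\<in>V. \<Sum>z\<in>V. 1 - a x y - a y z - a x z
      + a y x * a y z + a x y * a x z + a z x * a z y
      - of_bool (nonadj x y \<and> nonadj y z \<and> nonadj x z))"
  proof (intro sum.cong refl)
    fix x y z
    have s: "nonadj y x = nonadj x y" "nonadj z x = nonadj x z" "nonadj z y = nonadj y z"
      using nonadj_sym by blast+
    show "of_bool (\<not> nonadj x y \<and> \<not> nonadj y z \<and> \<not> nonadj x z)
      = 1 - a x y - a y z - a x z + a y x * a y z + a x y * a x z + a z x * a z y
        - of_bool (nonadj x y \<and> nonadj y z \<and> nonadj x z)"
      unfolding a_def s by (cases "nonadj x y"; cases "nonadj x z"; cases "nonadj y z"; simp)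
  qed
  also have "\<dots> = int (card V)^3 - 3 * int (card V) * (\<Sum>v\<in>V. int (nd v)) + 3 * (\<Sum>v\<in>V. int (nd v)^2)
    - int (card (triples nonadj V))"
  proof -
    have 1: "(\<Sum>x\<in>V. \<Sum>y\<in>V. \<Sum>z\<in>V. a x y) = int (card V) * (\<Sum>v\<in>V. int (nd v))"
      by (simp add: nd flip: sum_distrib_left)
    have 2: "(\<Sum>x\<in>V. \<Sum>y\<in>V. \<Sum>z\<in>V. a y z) = int (card V) * (\<Sum>v\<in>V. int (nd v))"
      by (simp add: nd)
    have 3: "(\<Sum>x\<in>V. \<Sum>y\<in>V. \<Sum>z\<in>V. a x z) = int (card V) * (\<Sum>v\<in>V. int (nd v))"
      by (simp add: nd flip: sum_distrib_left)
    have 4: "(\<Sum>y\<in>V. \<Sum>z\<in>V. a x y * a x z) = int (nd x)^2" for x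
      by (simp add: nd power2_eq_square flip: sum_product)
    have 5: "(\<Sum>x\<in>V. \<Sum>y\<in>V. \<Sum>z\<in>V. a y x * a y z) = (\<Sum>v\<in>V. int (nd v)^2)"
      by (subst sum.swap) (simp add: 4)
    have 6: "(\<Sum>x\<in>V. \<Sum>y\<in>V. \<Sum>z\<in>V. a z x * a z y) = (\<Sum>v\<in>V. int (nd v)^2)"
    proof -
      have "(\<Sum>x\<in>V. \<Sum>y\<in>V. \<Sum>z\<in>V. a z x * a z y) = (\<Sum>x\<in>V. \<Sum>z\<in>V. \<Sum>y\<in>V. a z x * a z y)"
        by (rule sum.cong[OF refl], rule sum.swap)
      also have "\<dots> = (\<Sum>z\<in>V. \<Sum>x\<in>V. \<Sum>y\<in>V. a z x * a z y)"
        by (rule sum.swap)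
      finally show ?thesis by (simp add: 4)
    qed
    have 7: "(\<Sum>x\<in>V. \<Sum>y\<in>V. \<Sum>z\<in>V. of_bool (nonadj x y \<and> nonadj y z \<and> nonadj x z)) = int (card (triples nonadj V))"
      unfolding triples_def card_triples_eq_sum[OF finite_V] by simp
    show ?thesis
      unfolding sum.distrib sum_subtractf 1 2 3 4 5 6 7 by (simp add: power3_eq_cube)
  qed
  finally show ?thesis .
qed

lemma clique_extend:
  assumes "T \<in> cliques V E r" "codeg V E T > 0"
  obtains v where "v \<in> common_nbrs V E T" "insert v T \<in> cliques V E (Suc r)"
proof -
  have "common_nbrs V E T \<noteq> {}" using assms(2) by (auto simp: codeg_def)
  then show ?thesis using that insert_clique[OF assms(1)] by blast
qed

end

section \<open>Codegree inequalities when every vertex has few non-neighbours\<close>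

locale dense_graph = sgraph V E for V :: "'a set" and E :: "'a set set" +
  fixes b :: nat
  assumes nd_le: "v \<in> V \<Longrightarrow> nd v \<le> b"
begin

text \<open>The common neighbours lost by adding \<open>x\<close> to the face are non-neighbours of
  \<open>x\<close>.\<close>

lemma codeg_face_le:
  assumes "S \<in> cliques V E k" "x \<in> S"
  shows "codeg V E (S - {x}) \<le> codeg V E S + b"
proof -
  have "codeg V E (S - {x}) \<le> card (common_nbrs V E S \<union> nbh nonadj V x)"
    unfolding codeg_def
    by (rule card_mono)
       (auto simp: common_nbrs_def nbh_def nonadj_def insert_commute finite_V)
  also have "\<dots> \<le> codeg V E S + nd x"
    unfolding codeg_def by (rule card_Un_le)
  finally show ?thesis using nd_le[of x] cliqueD(3)[OF assms(1)] assms(2) by fastforce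
qed

text \<open>Union bound: a vertex outside the common neighbourhood is a non-neighbour of some vertex
  of \<open>S\<close>.\<close>

lemma codeg_lower:
  assumes "S \<in> cliques V E k"
  shows "card V \<le> codeg V E S + k * b"
proof -
  note S = cliqueD[OF assms]
  have "card V \<le> card (common_nbrs V E S \<union> (\<Union>x\<in>S. nbh nonadj V x))"
    by (rule card_mono)
       (use S finite_V finite_nbh in \<open>auto simp: finite_common_nbrs common_nbrs_def nbh_def nonadj_def insert_commute\<close>)
  also have "\<dots> \<le> codeg V E S + card (\<Union>x\<in>S. nbh nonadj V x)"
    unfolding codeg_def by (rule card_Un_le)
  also have "card (\<Union>x\<in>S. nbh nonadj V x) \<le> (\<Sum>x\<in>S. nd x)"
    by (rule card_UN_le[OF S(1)])
  also have "\<dots> \<le> (\<Sum>x\<in>S. b)"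
    by (rule sum_mono) (use S(3) nd_le in blast)
  finally show ?thesis using S(2) by simp
qed

text \<open>The degrees of the vertices of \<open>S\<close> are summed by counting, for every vertex
  \<open>v\<close>, its neighbours in \<open>S\<close>. That number is compared with the number of
  faces of \<open>S\<close> inside the neighbourhood of \<open>v\<close>.\<close>

lemma sum_codeg_faces:
  assumes S: "S \<in> cliques V E k" and k: "2 \<le> k"
  shows "2 * card V + (k - 2) * codeg V E S \<le> (\<Sum>x\<in>S. codeg V E (S - {x})) + k * b"
proof -
  define N where "N v = {x. {v, x} \<in> E}" for v
  have finS: "finite S" and cS: "card S = k" and SV: "S \<subseteq> V" using cliqueD[OF S] by auto
  have codeg: "codeg V E T = (\<Sum>v\<in>V. of_bool (T \<subseteq> N v))" for T
    unfolding codeg_def common_nbrs_def card_eq_sum_of_bool[OF finite_V]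
    by (rule sum.cong) (auto simp: N_def)
  have "k * card V = (\<Sum>x\<in>S. degree V E x + nd x)"
    using cS by (simp add: degree_plus_nd)
  also have "\<dots> \<le> (\<Sum>x\<in>S. degree V E x + b)"
    by (rule sum_mono) (use SV nd_le in auto)
  also have "\<dots> = (\<Sum>x\<in>S. degree V E x) + k * b"
    using cS by (simp add: sum.distrib)
  also have "(\<Sum>x\<in>S. degree V E x) = (\<Sum>v\<in>V. card (S \<inter> N v))"
  proof -
    have "(\<Sum>x\<in>S. degree V E x) = (\<Sum>x\<in>S. \<Sum>v\<in>V. of_bool (x \<in> N v))"
      unfolding degree_def card_eq_sum_of_bool[OF finite_V] by (simp add: N_def insert_commute)
    also have "\<dots> = (\<Sum>v\<in>V. \<Sum>x\<in>S. of_bool (x \<in> N v))" by (rule sum.swap)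
    also have "\<dots> = (\<Sum>v\<in>V. card (S \<inter> N v))" using finS by simp
    finally show ?thesis .
  qed
  finally have deg: "k * card V \<le> (\<Sum>v\<in>V. card (S \<inter> N v)) + k * b" .
  \<comment> \<open>Equality holds if \<open>B\<close> misses at most one vertex of
    \<open>S\<close>; if it misses two, the left side is at most \<open>k - 2\<close>.\<close>
  have pointwise: "card (S \<inter> B) + (k - 2) * of_bool (S \<subseteq> B) \<le> (\<Sum>x\<in>S. of_bool (S - {x} \<subseteq> B)) + (k - 2)" for B
  proof -
    consider "S \<subseteq> B" | x where "x \<in> S" "x \<notin> B" "S - {x} \<subseteq> B"
      | x y where "x \<in> S" "y \<in> S" "x \<noteq> y" "x \<notin> B" "y \<notin> B" by blast
    then show ?thesis
    proof cases
      case 1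
      then have "S \<inter> B = S" "\<And>x. S - {x} \<subseteq> B" by auto
      then show ?thesis using cS by simp
    next
      case 2
      have "S \<inter> B = S - {x}" using 2 by auto
      then have "card (S \<inter> B) = k - 1" using 2(1) cS finS by simp
      moreover have "(\<Sum>y\<in>{x}. of_bool (S - {y} \<subseteq> B)) \<le> (\<Sum>x\<in>S. of_bool (S - {x} \<subseteq> B) :: nat)"
        by (rule sum_mono2) (use 2 finS in auto)
      ultimately show ?thesis using 2 k by auto
    next
      case 3
      have "card (S \<inter> B) \<le> card (S - {x, y})"
        by (rule card_mono) (use 3 finS in auto)
      also have "\<dots> = k - 2" using 3 cS finS by (simp add: card_Diff_subset)
      finally show ?thesis using 3 by auto
    qed
  qed
  have "(\<Sum>v\<in>V. card (S \<inter> N v)) + (k - 2) * codeg V E S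
      = (\<Sum>v\<in>V. card (S \<inter> N v) + (k - 2) * of_bool (S \<subseteq> N v))"
    by (simp only: codeg sum.distrib sum_distrib_left)
  also have "\<dots> \<le> (\<Sum>v\<in>V. (\<Sum>x\<in>S. of_bool (S - {x} \<subseteq> N v)) + (k - 2))"
    by (intro sum_mono pointwise)
  also have "\<dots> = (\<Sum>x\<in>S. codeg V E (S - {x})) + (k - 2) * card V"
    unfolding codeg sum.distrib by (subst sum.swap) simp
  finally have "(\<Sum>v\<in>V. card (S \<inter> N v)) + (k - 2) * codeg V E S
    \<le> (\<Sum>x\<in>S. codeg V E (S - {x})) + (k - 2) * card V" .
  moreover have "k * card V = (k - 2) * card V + 2 * card V"
    using k by (metis add.commute add_mult_distrib le_add_diff_inverse)
  ultimately show ?thesis using deg by linarith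
qed

end

section \<open>Four-cliques against triangles\<close>

text \<open>Truncation costs at most \<open>c\<close> per term. If at most two terms exceed
  \<open>b\<close>, the surplus \<open>2 * c\<close> pays for it; if three do, the truncated sum is
  already at least \<open>3 * b + r\<close>.\<close>

lemma sum_min_four:
  fixes f :: "'a \<Rightarrow> nat"
  assumes "card S = 4" and "2 * (b + r) + 2 * c \<le> (\<Sum>x\<in>S. f x)"
    and "\<And>x. x \<in> S \<Longrightarrow> f x \<le> c + b" and "\<And>x. x \<in> S \<Longrightarrow> r \<le> f x" and "r \<le> b"
  shows "2 * (b + r) \<le> (\<Sum>x\<in>S. min (f x) b)"
proof -
  obtain p q s t where S: "S = {p, q, s, t}" and d: "p \<noteq> q" "p \<noteq> s" "p \<noteq> t" "q \<noteq> s" "q \<noteq> t" "s \<noteq> t"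
    using assms(1) by (auto simp: numeral_eq_Suc card_Suc_eq)
  have "f p \<le> c + b" "f q \<le> c + b" "f s \<le> c + b" "f t \<le> c + b"
    "r \<le> f p" "r \<le> f q" "r \<le> f s" "r \<le> f t"
    using assms(3,4) S by auto
  then show ?thesis using assms(2,5) d unfolding S by (simp add: min_def)
qed

text \<open>If \<open>r < b\<close>, the sum forces exactly two terms to be \<open>b\<close>; if
  \<open>r = b\<close>, all four are.\<close>

lemma two_values_four:
  fixes f :: "'a \<Rightarrow> nat"
  assumes "card S = 4" and "(\<Sum>x\<in>S. f x) = 2 * (b + r)" and "r \<le> b"
    and vals: "\<And>x. x \<in> S \<Longrightarrow> f x = r \<or> f x = b"
  shows "\<exists>p\<in>S. \<exists>q\<in>S. p \<noteq> q \<and> f p = b \<and> f q = b"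
proof -
  obtain p q s t where S: "S = {p, q, s, t}" and d: "p \<noteq> q" "p \<noteq> s" "p \<noteq> t" "q \<noteq> s" "q \<noteq> t" "s \<noteq> t"
    using assms(1) by (auto simp: numeral_eq_Suc card_Suc_eq)
  have "f p + (f q + (f s + f t)) = 2 * b + 2 * r"
    using assms(2) d unfolding S by simp
  moreover have "f p = r \<or> f p = b" "f q = r \<or> f q = b" "f s = r \<or> f s = b" "f t = r \<or> f t = b"
    using vals S by auto
  ultimately have "f p = b \<and> f q = b \<or> f p = b \<and> f s = b \<or> f p = b \<and> f t = b
      \<or> f q = b \<and> f s = b \<or> f q = b \<and> f t = b \<or> f s = b \<and> f t = b"
    using assms(3) by (elim disjE) simp_all
  then show ?thesis unfolding S using d by blast
qed

locale dense4_graph = dense_graph V E b for V :: "'a set" and E :: "'a set set" and b :: nat +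
  fixes r :: nat
  assumes card_V: "card V = 3 * b + r" and r_pos: "0 < r" and r_le: "r \<le> b"
begin

lemma codeg_triangle_ge: "T \<in> cliques V E 3 \<Longrightarrow> r \<le> codeg V E T"
  using codeg_lower[of T 3] card_V by simp

text \<open>For \<open>d \<le> b\<close> the gap is \<open>(d - r) * (b - d)\<close>; above
  \<open>b\<close> it is \<open>r * (d - b)\<close>.\<close>

lemma chord_min: "r \<le> d \<Longrightarrow> d * min d b + b * r \<le> (b + r) * d"
proof (cases "d \<le> b")
  case True
  assume "r \<le> d"
  then obtain i where i: "d = r + i" using le_Suc_ex by blast
  obtain j where j: "b = d + j" using True le_Suc_ex by blast
  show ?thesis using i unfolding j by (simp add: min_def algebra_simps)
qed (simp add: min_def algebra_simps)

lemma chord_min_eqD: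
  assumes "d * min d b + b * r = (b + r) * d" "r \<le> d"
  shows "d = r \<or> d = b"
proof (cases "d \<le> b")
  case True
  obtain i where i: "d = r + i" using assms(2) le_Suc_ex by blast
  obtain j where j: "b = d + j" using True le_Suc_ex by blast
  have "i * j = 0" using assms(1) i unfolding j by (simp add: min_def algebra_simps)
  then show ?thesis using i j by auto
next
  case False
  then have "b * r = r * d" using assms(1) by (simp add: min_def algebra_simps)
  then show ?thesis using r_pos by simp
qed

lemma K4_faces_min:
  assumes S: "S \<in> cliques V E 4"
  shows "2 * (b + r) \<le> (\<Sum>x\<in>S. min (codeg V E (S - {x})) b)"
proof (rule sum_min_four[where c = "codeg V E S"])
  show "card S = 4" using cliqueD(2)[OF S] .
  show "2 * (b + r) + 2 * codeg V E S \<le> (\<Sum>x\<in>S. codeg V E (S - {x}))"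
    using sum_codeg_faces[OF S] card_V by simp
  show "codeg V E (S - {x}) \<le> codeg V E S + b" if "x \<in> S" for x
    using codeg_face_le[OF S that] .
  show "r \<le> codeg V E (S - {x})" if "x \<in> S" for x
    using remove_clique(1)[of S 3 x] S that by (intro codeg_triangle_ge) (simp add: numeral_eq_Suc)
qed (rule r_le)

text \<open>In a \<open>K\<^sub>5\<close>-free graph no triangle has codegree above \<open>b\<close>. In general truncating at \<open>b\<close>
  preserves the bound for the faces of a 4-clique, and \<open>d\<^sup>2\<close> may be replaced by its chord over
  \<open>{r..b}\<close>.\<close>
lemma K4_sum_chain:
  "(\<Sum>S\<in>cliques V E 4. 2 * (b + r)) + b * r * kr V E 3
     \<le> (\<Sum>S\<in>cliques V E 4. \<Sum>x\<in>S. min (codeg V E (S - {x})) b) + b * r * kr V E 3"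
  "(\<Sum>S\<in>cliques V E 4. \<Sum>x\<in>S. min (codeg V E (S - {x})) b) + b * r * kr V E 3
     = (\<Sum>T\<in>cliques V E 3. codeg V E T * min (codeg V E T) b + b * r)"
  "(\<Sum>T\<in>cliques V E 3. (b + r) * codeg V E T) = 4 * (b + r) * kr V E 4"
proof -
  show "(\<Sum>S\<in>cliques V E 4. 2 * (b + r)) + b * r * kr V E 3
     \<le> (\<Sum>S\<in>cliques V E 4. \<Sum>x\<in>S. min (codeg V E (S - {x})) b) + b * r * kr V E 3"
    by (intro add_mono sum_mono K4_faces_min order_refl)
  show "(\<Sum>S\<in>cliques V E 4. \<Sum>x\<in>S. min (codeg V E (S - {x})) b) + b * r * kr V E 3
     = (\<Sum>T\<in>cliques V E 3. codeg V E T * min (codeg V E T) b + b * r)"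
    using sum_clique_weights[of "\<lambda>T. min (codeg V E T) b" 3]
    by (simp add: sum.distrib kr_def eval_nat_numeral)
  show "(\<Sum>T\<in>cliques V E 3. (b + r) * codeg V E T) = 4 * (b + r) * kr V E 4"
    using sum_codeg[of 3] unfolding sum_distrib_left[symmetric] by simp
qed

text \<open>The chain gives \<open>2 * (b + r) * kr V E 4 + b * r * kr V E 3\<close> on the left and
  \<open>4 * (b + r) * kr V E 4\<close> on the right.\<close>

lemma kr_4_ge: "b * r * kr V E 3 \<le> 2 * (b + r) * kr V E 4"
proof -
  have "(\<Sum>T\<in>cliques V E 3. codeg V E T * min (codeg V E T) b + b * r)
      \<le> (\<Sum>T\<in>cliques V E 3. (b + r) * codeg V E T)"
    by (intro sum_mono chord_min codeg_triangle_ge)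
  moreover have "(\<Sum>S\<in>cliques V E 4. 2 * (b + r)) = 2 * (b + r) * kr V E 4"
    by (simp add: kr_def)
  ultimately show ?thesis using K4_sum_chain by linarith
qed

section \<open>Structure forced by equality in the four-clique bound\<close>

context
  assumes eq: "b * r * kr V E 3 = 2 * (b + r) * kr V E 4"
begin

text \<open>The two ends of the chain coincide, so both termwise estimates are tight, and hence
  tight in every term.\<close>

lemma sums_eq:
  "(\<Sum>S\<in>cliques V E 4. 2 * (b + r)) = (\<Sum>S\<in>cliques V E 4. \<Sum>x\<in>S. min (codeg V E (S - {x})) b)"
  "(\<Sum>T\<in>cliques V E 3. codeg V E T * min (codeg V E T) b + b * r) = (\<Sum>T\<in>cliques V E 3. (b + r) * codeg V E T)"
proof -
  have "(\<Sum>T\<in>cliques V E 3. codeg V E T * min (codeg V E T) b + b * r)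
      \<le> (\<Sum>T\<in>cliques V E 3. (b + r) * codeg V E T)"
    by (intro sum_mono chord_min codeg_triangle_ge)
  moreover have "(\<Sum>S\<in>cliques V E 4. 2 * (b + r)) = 2 * (b + r) * kr V E 4"
    by (simp add: kr_def)
  ultimately show "(\<Sum>S\<in>cliques V E 4. 2 * (b + r)) = (\<Sum>S\<in>cliques V E 4. \<Sum>x\<in>S. min (codeg V E (S - {x})) b)"
    "(\<Sum>T\<in>cliques V E 3. codeg V E T * min (codeg V E T) b + b * r) = (\<Sum>T\<in>cliques V E 3. (b + r) * codeg V E T)"
    using K4_sum_chain eq by linarith+
qed

lemma codeg_triangle_cases: "T \<in> cliques V E 3 \<Longrightarrow> codeg V E T = r \<or> codeg V E T = b"
  using sum_mono_inv[OF sums_eq(2)] chord_min codeg_triangle_ge finite_cliques[OF finite_V]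
    chord_min_eqD by metis

lemma K4_face: "S \<in> cliques V E 4 \<Longrightarrow> x \<in> S \<Longrightarrow> S - {x} \<in> cliques V E 3"
  using remove_clique(1)[of S 3 x] by (simp add: eval_nat_numeral)

text \<open>Face codegrees are \<open>r\<close> or \<open>b\<close>, so truncation at
  \<open>b\<close> changes nothing.\<close>

lemma K4_faces:
  assumes S: "S \<in> cliques V E 4"
  shows "(\<Sum>x\<in>S. codeg V E (S - {x})) = 2 * (b + r)"
proof -
  have "2 * (b + r) = (\<Sum>x\<in>S. min (codeg V E (S - {x})) b)"
    using sum_mono_inv[OF sums_eq(1) K4_faces_min] finite_cliques[OF finite_V] S by blast
  also have "\<dots> = (\<Sum>x\<in>S. codeg V E (S - {x}))"
    using codeg_triangle_cases[OF K4_face[OF S]] r_le by (intro sum.cong) (auto simp: min_def)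
  finally show ?thesis ..
qed

text \<open>A positive codegree would push the lower bound of \<open>sum_codeg_faces\<close> above
  the exact face sum. So the graph has no 5-clique.\<close>

lemma codeg_K4: "S \<in> cliques V E 4 \<Longrightarrow> codeg V E S = 0"
  using sum_codeg_faces[of S 4] K4_faces[of S] card_V by simp

text \<open>\<open>x\<close> completes the face to a 4-clique, which has no common neighbour. So all
  \<open>b\<close> common neighbours of the face are non-neighbours of \<open>x\<close>, and
  \<open>x\<close> has at most \<open>b\<close> of those.\<close>

lemma part_from_face:
  assumes S: "S \<in> cliques V E 4" and p: "p \<in> S" and b: "codeg V E (S - {p}) = b"
    and x: "x \<in> common_nbrs V E (S - {p})"
  shows "nbh nonadj V x = common_nbrs V E (S - {p})"
proof (rule card_seteq[symmetric])
  let ?T = "S - {p}"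
  show "common_nbrs V E ?T \<subseteq> nbh nonadj V x"
  proof
    fix y assume y: "y \<in> common_nbrs V E ?T"
    have K: "insert x ?T \<in> cliques V E 4"
      using insert_clique[OF K4_face[OF S p] x] by (simp add: eval_nat_numeral)
    have "{x, y} \<notin> E"
    proof
      assume "{x, y} \<in> E"
      then have "y \<in> common_nbrs V E (insert x ?T)"
        using y by (auto simp: common_nbrs_def insert_commute)
      then show False
        using codeg_K4[OF K] finite_common_nbrs by (auto simp: codeg_def)
    qed
    then show "y \<in> nbh nonadj V x" using y by (simp add: nbh_def nonadj_def common_nbrs_def)
  qed
  show "nd x \<le> card (common_nbrs V E ?T)"
    using nd_le[of x] x b by (simp add: codeg_def common_nbrs_def)
qed (simp add: finite_V finite_nbh)

text \<open>Greedy extension from the empty clique: up to three vertices always have at least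
  \<open>r > 0\<close> common neighbours.\<close>

lemma K4_exists: "cliques V E 4 \<noteq> {}"
proof -
  have ex: "cliques V E (Suc k) \<noteq> {}" if ne: "cliques V E k \<noteq> {}" and k: "k \<le> 3" for k
  proof -
    from ne obtain T where T: "T \<in> cliques V E k" by auto
    have "k * b \<le> 3 * b" using k by simp
    then have "codeg V E T > 0" using codeg_lower[OF T] card_V r_pos by linarith
    then show ?thesis using clique_extend[OF T] by blast
  qed
  have "cliques V E 0 \<noteq> {}" by (simp add: cliques_0 finite_V)
  from ex[OF ex[OF ex[OF ex[OF this]]]] show ?thesis by (simp add: eval_nat_numeral)
qed

lemma extremal_partition:
  obtains V1 V2 where
    "V1 \<subseteq> V" "V2 \<subseteq> V" "V1 \<inter> V2 = {}" "V1 \<noteq> {}" "V2 \<noteq> {}" "card V1 = b" "card V2 = b"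
    "\<forall>x\<in>V1. nbh nonadj V x = V1" "\<forall>x\<in>V2. nbh nonadj V x = V2"
proof -
  obtain S where S: "S \<in> cliques V E 4" using K4_exists by blast
  have "\<exists>p\<in>S. \<exists>q\<in>S. p \<noteq> q \<and> codeg V E (S - {p}) = b \<and> codeg V E (S - {q}) = b"
    by (rule two_values_four[OF cliqueD(2)[OF S] K4_faces[OF S] r_le]) (rule codeg_triangle_cases[OF K4_face[OF S]])
  then obtain p q where pq: "p \<in> S" "q \<in> S" "p \<noteq> q"
    and b: "codeg V E (S - {p}) = b" "codeg V E (S - {q}) = b" by blast
  let ?V1 = "common_nbrs V E (S - {p})" and ?V2 = "common_nbrs V E (S - {q})"
  have q: "q \<in> ?V2" and p: "p \<in> ?V1"
    using remove_clique(2)[of S 3] S pq by auto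
  note 1 = part_from_face[OF S pq(1) b(1)] and 2 = part_from_face[OF S pq(2) b(2)]
  \<comment> \<open>A common point \<open>x\<close> would have \<open>?V2\<close>, and so
    \<open>q\<close>, among its non-neighbours; but \<open>q\<close> lies in \<open>S - {p}\<close>,
    so \<open>x\<close> is adjacent to it.\<close>
  have "?V1 \<inter> ?V2 = {}"
  proof (rule ccontr)
    assume "?V1 \<inter> ?V2 \<noteq> {}"
    then obtain x where x: "x \<in> ?V1" "x \<in> ?V2" by auto
    have "q \<in> nbh nonadj V x" using q 2[OF x(2)] by simp
    then have "{x, q} \<notin> E" by (simp add: nbh_def nonadj_def)
    then show False using x(1) pq by (auto simp: common_nbrs_def)
  qed
  then show ?thesis
    using that[of ?V1 ?V2] 1 2 p q b by (auto simp: codeg_def common_nbrs_def)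
qed

lemma extremal_structure:
  obtains V0 V1 V2 where "V0 \<union> V1 \<union> V2 = V" "V0 \<inter> V1 = {}" "V0 \<inter> V2 = {}" "V1 \<inter> V2 = {}"
    "card V0 = b + r" "card V1 = b" "card V2 = b"
    "\<forall>x\<in>V0. \<forall>y\<in>V1. {x, y} \<in> E" "\<forall>x\<in>V0. \<forall>y\<in>V2. {x, y} \<in> E"
    "\<forall>x\<in>V1. \<forall>y\<in>V2. {x, y} \<in> E"
    "\<forall>x\<in>V1. \<forall>y\<in>V1. {x, y} \<notin> E" "\<forall>x\<in>V2. \<forall>y\<in>V2. {x, y} \<notin> E"
    "regular V0 (induced E V0) r" "kr V0 E 3 = 0"
proof -
  obtain V1 V2 where sub: "V1 \<subseteq> V" "V2 \<subseteq> V" and disj: "V1 \<inter> V2 = {}" and ne: "V1 \<noteq> {}" "V2 \<noteq> {}"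
    and card: "card V1 = b" "card V2 = b"
    and N1: "\<forall>x\<in>V1. nbh nonadj V x = V1" and N2: "\<forall>x\<in>V2. nbh nonadj V x = V2"
    by (rule extremal_partition)
  have fin: "finite V1" "finite V2" using sub finite_V by (auto dest: finite_subset)
  have adj1: "{y, x} \<in> E \<longleftrightarrow> x \<notin> V1" if "y \<in> V1" "x \<in> V" for x y
    using bspec[OF N1 that(1)] that by (auto simp: nbh_def nonadj_def)
  have adj2: "{y, x} \<in> E \<longleftrightarrow> x \<notin> V2" if "y \<in> V2" "x \<in> V" for x y
    using bspec[OF N2 that(1)] that by (auto simp: nbh_def nonadj_def)
  define V0 where "V0 = V - (V1 \<union> V2)"
  obtain p q where p: "p \<in> V1" and q: "q \<in> V2" using ne by auto
  have card0: "card V0 = b + r"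
    unfolding V0_def using sub disj card card_V fin
    by (simp add: card_Diff_subset card_Un_disjoint)
  have fin0: "finite V0" using finite_V by (simp add: V0_def)
  have V0p: "{p, x} \<in> E" "{x, p} \<in> E" "{q, x} \<in> E" "{x, q} \<in> E" if "x \<in> V0" for x
    using that adj1[OF p, of x] adj2[OF q, of x] by (auto simp: V0_def insert_commute)
  have pq: "{p, q} \<in> E" "{q, p} \<in> E" "p \<noteq> q" using adj1[OF p, of q] p q sub disj by (auto simp: insert_commute)
  have qp: "q \<notin> V1" "p \<notin> V2" using p q disj by auto
  have pqV: "p \<in> V" "q \<in> V" "p \<notin> V0" "q \<notin> V0" using p q sub by (auto simp: V0_def)
  \<comment> \<open>A triangle in \<open>V0\<close> together with \<open>p\<close> and
    \<open>q\<close> would be a 5-clique.\<close>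
  have tri: "cliques V0 E 3 = {}"
  proof (rule ccontr)
    assume "cliques V0 E 3 \<noteq> {}"
    then obtain T where T: "T \<in> cliques V0 E 3" by auto
    then have TV: "T \<in> cliques V E 3" by (auto simp: cliques_def V0_def)
    have T0: "T \<subseteq> V0" using T by (simp add: cliques_def)
    have "p \<in> common_nbrs V E T" using V0p T0 pqV by (auto simp: common_nbrs_def)
    then have K: "insert p T \<in> cliques V E 4" using insert_clique[OF TV] by simp
    have "q \<in> common_nbrs V E (insert p T)" using V0p T0 pqV pq by (auto simp: common_nbrs_def)
    then show False using codeg_K4[OF K] finite_common_nbrs by (auto simp: codeg_def)
  qed
  define e where "e x = card {y\<in>V0. {x, y} \<in> E}" for x
  have codeg_pq: "codeg V E {x, p, q} = e x" if "x \<in> V0" for x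
  proof -
    have "common_nbrs V E {x, p, q} = {y\<in>V0. {x, y} \<in> E}"
      unfolding common_nbrs_def V0_def
      using adj1[OF p] adj2[OF q] by (auto simp: insert_commute)
    then show ?thesis by (simp add: codeg_def e_def)
  qed
  have K3: "{x, p, q} \<in> cliques V E 3" if "x \<in> V0" for x
  proof -
    have "x \<noteq> p" "x \<noteq> q" using that pqV by auto
    then have "card {x, p, q} = 3" using pq by simp
    then show ?thesis using that V0p[OF that] pq pqV by (auto simp: cliques_def V0_def)
  qed
  have e_ge: "r \<le> e x" if "x \<in> V0" for x
    using codeg_triangle_ge[OF K3[OF that]] codeg_pq[OF that] by simp
  \<comment> \<open>An edge \<open>{x, y}\<close> in \<open>V0\<close> forms a 4-clique with
    \<open>p\<close> and \<open>q\<close>. Its faces through both \<open>x\<close> and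
    \<open>y\<close> have codegree at least \<open>b\<close>, because of \<open>V1\<close> and
    \<open>V2\<close>, so the face sum leaves at most \<open>2 * r\<close> for
    \<open>e x + e y\<close>.\<close>
  have e_eq: "e x = r" if x: "x \<in> V0" for x
  proof -
    have "e x > 0" using e_ge[OF x] r_pos by simp
    then obtain y where y: "y \<in> V0" "{x, y} \<in> E" by (auto simp: e_def card_gt_0_iff)
    have ne: "x \<noteq> y" "x \<noteq> p" "x \<noteq> q" "y \<noteq> p" "y \<noteq> q"
      using simple_graph_edge[OF simple y(2)] x y(1) pqV by auto
    let ?S = "{x, y, p, q}"
    have S: "?S \<in> cliques V E 4"
      using insert_clique[OF K3[OF y(1)], of x] x y V0p[OF x] pqV
      by (auto simp: common_nbrs_def V0_def)
    have faces: "?S - {x} = {y, p, q}" "?S - {y} = {x, p, q}" "?S - {p} = {x, y, q}" "?S - {q} = {x, y, p}"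
      using ne pq by auto
    have sum: "e y + (e x + (codeg V E {x, y, q} + codeg V E {x, y, p})) = 2 * b + 2 * r"
      using K4_faces[OF S] ne pq faces codeg_pq x y(1) by simp
    have "V1 \<subseteq> common_nbrs V E {x, y, q}" "V2 \<subseteq> common_nbrs V E {x, y, p}"
      using adj1 adj2 x y pqV qp sub by (auto simp: common_nbrs_def V0_def)
    then have "b \<le> codeg V E {x, y, q}" "b \<le> codeg V E {x, y, p}"
      using card_mono[OF finite_common_nbrs] card unfolding codeg_def by metis+
    then show ?thesis using sum e_ge[OF x] e_ge[OF y(1)] by (intro antisym) linarith+
  qed
  show ?thesis
  proof (rule that[of V0 V1 V2])
    show "\<forall>x\<in>V0. \<forall>y\<in>V1. {x, y} \<in> E"
    proof (intro ballI)
      fix x y assume "x \<in> V0" "y \<in> V1"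
      then show "{x, y} \<in> E" using adj1[of y x] by (simp add: V0_def insert_commute)
    qed
    show "\<forall>x\<in>V0. \<forall>y\<in>V2. {x, y} \<in> E"
    proof (intro ballI)
      fix x y assume "x \<in> V0" "y \<in> V2"
      then show "{x, y} \<in> E" using adj2[of y x] by (simp add: V0_def insert_commute)
    qed
    show "\<forall>x\<in>V1. \<forall>y\<in>V2. {x, y} \<in> E"
    proof (intro ballI)
      fix x y assume "x \<in> V1" "y \<in> V2"
      then show "{x, y} \<in> E" using adj1[of x y] sub disj by blast
    qed
    show "\<forall>x\<in>V1. \<forall>y\<in>V1. {x, y} \<notin> E"
      using adj1 sub by (meson subsetD)
    show "\<forall>x\<in>V2. \<forall>y\<in>V2. {x, y} \<notin> E"
      using adj2 sub by (meson subsetD)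
    show "regular V0 (induced E V0) r"
      using e_eq by (simp add: regular_def degree_induced e_def)
    show "kr V0 E 3 = 0"
      by (simp add: kr_def tri)
  qed (use sub disj card card0 in \<open>auto simp: V0_def\<close>)
qed

end

section \<open>Triangles against edges\<close>

lemma cube_bound_V: "cube_bound b (card V) = 3 * b^3 + r^3"
  unfolding card_V using cube_bound_add[of r b 3] r_le r_pos by simp

lemma card_triples_V_le: "card (triples nonadj V) \<le> 3 * b^3 + r^3"
  using card_triples_le[of V nonadj b] finite_V nonadj_refl nonadj_sym nd_le r_le r_pos
  unfolding cube_bound_V by simp

text \<open>\<open>U\<close> is the total excess of the degrees over \<open>card V - b\<close>.
  Replacing the square of \<open>nd v\<close> by its tangent at \<open>b\<close> makes the triangle
  count linear in \<open>U\<close>.\<close>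

lemma kr_3_deficit:
  defines "U \<equiv> (\<Sum>v\<in>V. int b - int (nd v))"
  shows "2 * int (kr V E 2) = int (3*b+r) * int (2*b+r) + U"
    and "6 * int b * (int (b+r))^2 + 3 * int (b+r) * U + (3 * int b^3 + int r^3 - int (card (triples nonadj V)))
        \<le> 6 * int (kr V E 3)"
    and "U \<ge> 0"
proof -
  define D Q where "D = (\<Sum>v\<in>V. int (nd v))" and "Q = (\<Sum>v\<in>V. int (nd v)^2)"
  have U: "U = int (3*b+r) * int b - D" by (simp add: U_def D_def sum_subtractf card_V)
  have "int (2 * kr V E 2 + (\<Sum>v\<in>V. nd v)) = int ((3*b+r)^2)"
    using edge_count card_V by simp
  then have "2 * int (kr V E 2) = (int (3*b+r))^2 - D" by (simp add: D_def)
  then show "2 * int (kr V E 2) = int (3*b+r) * int (2*b+r) + U"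
    unfolding U by (simp add: power2_eq_square algebra_simps)
  show "U \<ge> 0" unfolding U_def by (rule sum_nonneg) (use nd_le in auto)
  have "(\<Sum>v\<in>V. 2 * int b * int (nd v) - int b^2) \<le> Q" unfolding Q_def
  proof (rule sum_mono)
    fix v show "2 * int b * int (nd v) - int b^2 \<le> int (nd v)^2"
      using zero_le_power2[of "int b - int (nd v)"] by (simp add: power2_diff algebra_simps)
  qed
  then have Q: "2 * int b * D - int (3*b+r) * int b^2 \<le> Q"
    by (simp add: sum_subtractf card_V D_def sum_distrib_left)
  have D: "D = int (3*b+r) * int b - U" using U by simp
  have "int (3*b+r) * int b^2 - 2 * int b * U \<le> Q"
    using Q unfolding D by (simp add: power2_eq_square algebra_simps)
  moreover have "6 * int (kr V E 3) = int (3*b+r)^3 - 3 * int (3*b+r) * (int (3*b+r) * int b - U) + 3 * Q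
      - int (card (triples nonadj V))"
    using triangle_count card_V unfolding D_def[symmetric] Q_def[symmetric] D by simp
  ultimately show "6 * int b * (int (b+r))^2 + 3 * int (b+r) * U + (3 * int b^3 + int r^3 - int (card (triples nonadj V)))
        \<le> 6 * int (kr V E 3)"
    by (simp add: power2_eq_square power3_eq_cube algebra_simps)
qed

text \<open>Cross-multiplying cancels the main terms of the edge and triangle counts. Two deficits
  with positive coefficients remain, one of triples and one of degrees, and equality will force both
  to vanish.\<close>

lemma kr_3_ge_aux:
  defines "U \<equiv> (\<Sum>v\<in>V. int b - int (nd v))"
  shows "int (3*b+r) * int (2*b+r) * (3 * int b^3 + int r^3 - int (card (triples nonadj V)))
     + 3 * int (b+r) * (4 * int b^2 + 3 * int b * int r + int r^2) * U
     \<le> 6 * (int (3*b+r) * int (2*b+r) * int (kr V E 3) - 2 * int b * (int (b+r))^2 * int (kr V E 2))"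
proof -
  let ?m = "int (3*b+r) * int (2*b+r)"
  let ?X = "3 * int b^3 + int r^3 - int (card (triples nonadj V))"
  have "?m * (6 * int b * (int (b+r))^2 + 3 * int (b+r) * U + ?X) \<le> ?m * (6 * int (kr V E 3))"
    using kr_3_deficit(2) unfolding U_def by (intro mult_left_mono) simp_all
  moreover have "6 * int b * (int (b+r))^2 * (2 * int (kr V E 2)) = 6 * int b * (int (b+r))^2 * (?m + U)"
    using kr_3_deficit(1) unfolding U_def by simp
  moreover have "?m * (6 * int b * (int (b+r))^2 + 3 * int (b+r) * U + ?X) - 6 * int b * (int (b+r))^2 * (?m + U)
      = ?m * ?X + 3 * int (b+r) * (4 * int b^2 + 3 * int b * int r + int r^2) * U"
    by (simp add: power2_eq_square algebra_simps)
  moreover have "6 * (?m * int (kr V E 3) - 2 * int b * (int (b+r))^2 * int (kr V E 2))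
      = ?m * (6 * int (kr V E 3)) - 6 * int b * (int (b+r))^2 * (2 * int (kr V E 2))"
    by (simp only: right_diff_distrib)
  ultimately show ?thesis by linarith
qed

lemma kr_3_ge: "2 * b * (b+r)^2 * kr V E 2 \<le> (3*b+r) * (2*b+r) * kr V E 3"
proof -
  have "0 \<le> 3 * int b^3 + int r^3 - int (card (triples nonadj V))"
    using card_triples_V_le by (simp flip: of_nat_power of_nat_mult of_nat_add)
  then have "0 \<le> int (3*b+r) * int (2*b+r) * (3 * int b^3 + int r^3 - int (card (triples nonadj V)))
     + 3 * int (b+r) * (4 * int b^2 + 3 * int b * int r + int r^2) * (\<Sum>v\<in>V. int b - int (nd v))"
    using kr_3_deficit(3) by (intro add_nonneg_nonneg mult_nonneg_nonneg) simp_all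
  then have "0 \<le> 6 * (int (3*b+r) * int (2*b+r) * int (kr V E 3) - 2 * int b * (int (b+r))^2 * int (kr V E 2))"
    using kr_3_ge_aux by linarith
  then have "int (2 * b * (b+r)^2 * kr V E 2) \<le> int ((3*b+r) * (2*b+r) * kr V E 3)"
    by (simp add: algebra_simps)
  then show ?thesis by (simp only: of_nat_le_iff)
qed

section \<open>Consequences of equality in the triangle bound\<close>

context
  assumes eq32: "2 * b * (b+r)^2 * kr V E 2 = (3*b+r) * (2*b+r) * kr V E 3"
begin

lemma nd_eq: "v \<in> V \<Longrightarrow> nd v = b"
  and card_triples_eq: "card (triples nonadj V) = cube_bound b (card V)"
proof -
  let ?X = "3 * int b^3 + int r^3 - int (card (triples nonadj V))"
  let ?U = "\<Sum>v\<in>V. int b - int (nd v)"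
  have X: "0 \<le> ?X"
    using card_triples_V_le by (simp flip: of_nat_power of_nat_mult of_nat_add)
  have "int (2 * b * (b+r)^2 * kr V E 2) = int ((3*b+r) * (2*b+r) * kr V E 3)" using eq32 by simp
  then have "6 * (int (3*b+r) * int (2*b+r) * int (kr V E 3) - 2 * int b * (int (b+r))^2 * int (kr V E 2)) = 0"
    by simp
  then have le: "int (3*b+r) * int (2*b+r) * ?X + 3 * int (b+r) * (4 * int b^2 + 3 * int b * int r + int r^2) * ?U \<le> 0"
    using kr_3_ge_aux by linarith
  have m: "int (3*b+r) * int (2*b+r) > 0" "3 * int (b+r) * (4 * int b^2 + 3 * int b * int r + int r^2) > 0"
    using r_pos r_le by (intro mult_pos_pos add_pos_nonneg; simp)+
  have "int (3*b+r) * int (2*b+r) * ?X \<ge> 0"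
    "3 * int (b+r) * (4 * int b^2 + 3 * int b * int r + int r^2) * ?U \<ge> 0"
    by (rule mult_nonneg_nonneg[OF less_imp_le[OF m(1)] X],
        rule mult_nonneg_nonneg[OF less_imp_le[OF m(2)] kr_3_deficit(3)])
  then have "int (3*b+r) * int (2*b+r) * ?X = 0"
    "3 * int (b+r) * (4 * int b^2 + 3 * int b * int r + int r^2) * ?U = 0"
    using le by linarith+
  then have X0: "?X = 0" and U0: "?U = 0"
    using m by (metis less_irrefl mult_eq_0_iff)+
  show "card (triples nonadj V) = cube_bound b (card V)"
    unfolding cube_bound_V using X0 by (simp flip: of_nat_power of_nat_mult of_nat_add)
  have "\<forall>v\<in>V. int b - int (nd v) = 0"
    using U0 by (subst (asm) sum_nonneg_eq_0_iff) (use finite_V nd_le in auto)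
  then show "nd v = b" if "v \<in> V" using that by auto
qed

text \<open>For an edge \<open>{v, u}\<close>, the relation \<open>nonadj\<close> on the
  \<open>2 * b + r\<close> neighbours of \<open>v\<close> is again extremal. Deleting the
  non-neighbours of \<open>u\<close> there is a tight step, so at least \<open>r\<close> points go
  and at most \<open>2 * b\<close> remain.\<close>

lemma codeg_edge_le:
  assumes "e \<in> cliques V E 2"
  shows "codeg V E e \<le> 2 * b"
proof -
  obtain v u where e: "e = {v, u}" "v \<noteq> u" using cliqueD(2)[OF assms] by (auto simp: card_2_iff)
  have v: "v \<in> V" "u \<in> V" "{v, u} \<in> E" using cliqueD(3,4)[OF assms] e by auto
  have b: "b > 0" using r_pos r_le by simp
  define A where "A = V - nbh nonadj V v"
  have u: "u \<in> A" using v by (simp add: A_def nbh_def nonadj_def)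
  have finA: "finite A" using finite_V by (simp add: A_def)
  have "card A = card V - nd v"
    unfolding A_def by (intro card_Diff_subset finite_nbh finite_V nbh_subset)
  then have cA: "card A = 2 * b + r" using nd_eq[OF v(1)] card_V by simp
  have tA: "card (triples nonadj A) = cube_bound b (card A)"
    using card_triples_extremal(1)[OF finite_V nonadj_refl nonadj_sym nd_le b card_triples_eq v(1)]
      nd_eq[OF v(1)] card_V cA unfolding A_def by simp
  have degA: "card (nbh nonadj A w) \<le> b" if "w \<in> A" for w
  proof -
    have "card (nbh nonadj A w) \<le> nd w"
      by (intro card_mono finite_nbh finite_V) (auto simp: nbh_def A_def)
    then show ?thesis using nd_le[of w] that by (simp add: A_def)
  qed
  have "(card (nbh nonadj A u))^3 + cube_bound b (2 * b + r - card (nbh nonadj A u)) = cube_bound b (2 * b + r)"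
    using card_triples_extremal(2)[OF finA nonadj_refl nonadj_sym degA b tA u] cA by simp
  moreover have "card (nbh nonadj A u) > 0"
    using u finA nonadj_refl by (auto simp: card_gt_0_iff nbh_def)
  ultimately have d: "r \<le> card (nbh nonadj A u)"
    using cube_bound_step_eqD r_le b by blast
  have "common_nbrs V E e = A - nbh nonadj A u"
    by (auto simp: e common_nbrs_def A_def nbh_def nonadj_def insert_commute)
  then have "codeg V E e = card A - card (nbh nonadj A u)"
    unfolding codeg_def using finA by (simp add: card_Diff_subset finite_nbh nbh_subset)
  then show ?thesis using cA d by simp
qed

text \<open>Edge codegrees lie between \<open>b + r\<close> and \<open>2 * b\<close>, so their
  squares lie below the chord over that interval. With the face sums of triangles this bounds
  \<open>kr V E 4\<close> from above, against \<open>kr_4_ge\<close>.\<close>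

lemma kr_4_eq: "b * r * kr V E 3 = 2 * (b + r) * kr V E 4"
proof -
  have faces: "3 * b + 2 * r + codeg V E S \<le> (\<Sum>x\<in>S. codeg V E (S - {x}))" if "S \<in> cliques V E 3" for S
    using sum_codeg_faces[OF that] card_V by simp
  have chord: "codeg V E e * codeg V E e + 2 * b * (b + r) \<le> (3 * b + r) * codeg V E e" if e: "e \<in> cliques V E 2" for e
  proof -
    obtain i where i: "codeg V E e = b + r + i"
      using codeg_lower[OF e] card_V le_Suc_ex[of "b + r" "codeg V E e"] by auto
    obtain j where j: "2 * b = codeg V E e + j"
      using codeg_edge_le[OF e] le_Suc_ex by blast
    have jb: "b = r + i + j" using i j by simp
    show ?thesis unfolding i jb by (simp add: algebra_simps)
  qed
  have "(\<Sum>S\<in>cliques V E 3. 3 * b + 2 * r + codeg V E S) \<le> (\<Sum>S\<in>cliques V E 3. \<Sum>x\<in>S. codeg V E (S - {x}))"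
    by (intro sum_mono faces)
  also have "\<dots> = (\<Sum>e\<in>cliques V E 2. codeg V E e * codeg V E e)"
    using sum_clique_weights[of "codeg V E" 2] by simp
  finally have 1: "(3 * b + 2 * r) * kr V E 3 + 4 * kr V E 4 \<le> (\<Sum>e\<in>cliques V E 2. codeg V E e * codeg V E e)"
    using sum_codeg[of 3] by (simp add: sum.distrib kr_def mult.commute)
  have "(\<Sum>e\<in>cliques V E 2. codeg V E e * codeg V E e + 2 * b * (b + r)) \<le> (\<Sum>e\<in>cliques V E 2. (3 * b + r) * codeg V E e)"
    by (intro sum_mono chord)
  also have "\<dots> = (3 * b + r) * (3 * kr V E 3)"
    using sum_codeg[of 2] unfolding sum_distrib_left[symmetric] by simp
  finally have 2: "(\<Sum>e\<in>cliques V E 2. codeg V E e * codeg V E e) + 2 * b * (b + r) * kr V E 2 \<le> (3 * b + r) * (3 * kr V E 3)"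
    by (simp add: sum.distrib kr_def mult.commute)
  have "(3 * b + 2 * r) * kr V E 3 + 4 * kr V E 4 + 2 * b * (b + r) * kr V E 2 \<le> (3 * b + r) * (3 * kr V E 3)"
    using 1 2 by linarith
  \<comment> \<open>The factor \<open>b + r\<close> turns the edge term into the left side of
    \<open>eq32\<close>, which eliminates \<open>kr V E 2\<close>.\<close>
  then have "(b + r) * ((3 * b + 2 * r) * kr V E 3 + 4 * kr V E 4 + 2 * b * (b + r) * kr V E 2)
      \<le> (b + r) * ((3 * b + r) * (3 * kr V E 3))" by (rule mult_le_mono2)
  then have "(b + r) * (3 * b + 2 * r) * kr V E 3 + 4 * (b + r) * kr V E 4 + 2 * b * (b + r)^2 * kr V E 2
      \<le> (b + r) * (3 * b + r) * 3 * kr V E 3"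
    by (simp add: power2_eq_square algebra_simps)
  then have "2 * (b + r) * kr V E 4 \<le> b * r * kr V E 3"
    unfolding eq32 by (simp add: algebra_simps)
  then show ?thesis using kr_4_ge by simp
qed

end

end

section \<open>Counting cliques in the extremal graphs\<close>

text \<open>A clique meets \<open>I\<close> in at most one vertex, and each vertex of
  \<open>I\<close> extends every clique of \<open>U\<close>.\<close>

lemma kr_join_independent:
  assumes fin: "finite U" "finite I" and disj: "U \<inter> I = {}"
    and ind: "\<And>x y. x \<in> I \<Longrightarrow> y \<in> I \<Longrightarrow> {x, y} \<notin> E"
    and join: "\<And>x y. x \<in> U \<Longrightarrow> y \<in> I \<Longrightarrow> {x, y} \<in> E"
  shows "kr (U \<union> I) E (Suc s) = kr U E (Suc s) + card I * kr U E s"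
proof -
  let ?g = "\<lambda>(x, K). insert x K"
  have split: "cliques (U \<union> I) E (Suc s) = cliques U E (Suc s) \<union> ?g ` (I \<times> cliques U E s)"
  proof (intro equalityI subsetI)
    fix K assume K: "K \<in> cliques (U \<union> I) E (Suc s)"
    show "K \<in> cliques U E (Suc s) \<union> ?g ` (I \<times> cliques U E s)"
    proof (cases "K \<inter> I = {}")
      case True
      then show ?thesis using K by (auto simp: cliques_def)
    next
      case False
      then obtain x where x: "x \<in> K" "x \<in> I" by auto
      have "finite K" using K fin by (auto simp: cliques_def dest: finite_subset)
      moreover have "K - {x} \<subseteq> U"
      proof
        fix y assume y: "y \<in> K - {x}"
        then have "{x, y} \<in> E" using K x(1) by (auto simp: cliques_def)
        then show "y \<in> U" using ind[OF x(2), of y] K y by (auto simp: cliques_def)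
      qed
      ultimately have "K - {x} \<in> cliques U E s" using K x by (auto simp: cliques_def)
      moreover have "K = ?g (x, K - {x})" using x by auto
      ultimately show ?thesis using x(2) by blast
    qed
  next
    fix K assume "K \<in> cliques U E (Suc s) \<union> ?g ` (I \<times> cliques U E s)"
    then consider "K \<in> cliques U E (Suc s)" | x L where "x \<in> I" "L \<in> cliques U E s" "K = insert x L" by auto
    then show "K \<in> cliques (U \<union> I) E (Suc s)"
    proof cases
      case 2
      have "finite L" "x \<notin> L" using 2 fin disj by (auto simp: cliques_def dest: finite_subset)
      then show ?thesis using 2 join by (auto simp: cliques_def insert_commute subset_iff)
    qed (auto simp: cliques_def)
  qed
  have inj: "inj_on ?g (I \<times> cliques U E s)"
  proof (rule inj_onI, clarsimp)
    fix x K y L assume a: "x \<in> I" "K \<in> cliques U E s" "y \<in> I" "L \<in> cliques U E s" "insert x K = insert y L"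
    then have "x \<notin> K" "x \<notin> L" "y \<notin> K" "y \<notin> L" using disj by (auto simp: cliques_def)
    then show "x = y \<and> K = L" using a(5) by (metis insertE insertI1 insert_ident)
  qed
  have "card (cliques (U \<union> I) E (Suc s)) = card (cliques U E (Suc s)) + card (?g ` (I \<times> cliques U E s))"
    unfolding split by (rule card_Un_disjoint) (use fin disj in \<open>auto simp: finite_cliques cliques_def\<close>)
  then show ?thesis by (simp add: kr_def card_image[OF inj] card_cartesian_product)
qed

text \<open>Joining the two independent parts multiplies the clique polynomial of \<open>V0\<close>,
  which stops at the edges, by \<open>(1 + b * x)^2\<close>. Parity comes from the degree sum in
  \<open>V0\<close>.\<close>

lemma kr_extremal:
  assumes E: "simple_graph V E" and V: "V0 \<union> V1 \<union> V2 = V"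
    and disj: "V0 \<inter> V1 = {}" "V0 \<inter> V2 = {}" "V1 \<inter> V2 = {}"
    and card: "card V0 = b + r" "card V1 = b" "card V2 = b"
    and join: "\<forall>x\<in>V0. \<forall>y\<in>V1. {x, y} \<in> E" "\<forall>x\<in>V0. \<forall>y\<in>V2. {x, y} \<in> E"
      "\<forall>x\<in>V1. \<forall>y\<in>V2. {x, y} \<in> E"
    and ind: "\<forall>x\<in>V1. \<forall>y\<in>V1. {x, y} \<notin> E" "\<forall>x\<in>V2. \<forall>y\<in>V2. {x, y} \<notin> E"
    and reg: "regular V0 (induced E V0) r" and tri: "kr V0 E 3 = 0"
  shows "even ((b + r) * r)" "2 * kr V E 2 = (3*b+r) * (2*b+r)" "kr V E 3 = (b+r)^2 * b" "2 * kr V E 4 = (b+r) * r * b^2"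
proof -
  interpret V0: sgraph V0 "induced E V0"
    using simple_graph_induced[OF E] V by unfold_locales auto
  have fin: "finite V0" "finite V1" "finite V2" using E V by (auto simp: simple_graph_def)
  have k2: "2 * kr V0 E 2 = (b + r) * r"
    using V0.sum_degree reg card(1) by (simp add: regular_def kr_induced)
  then show "even ((b + r) * r)" by (rule dvdI[OF sym])
  have "cliques V0 E 3 = {}" using tri fin by (simp add: kr_def finite_cliques)
  then have k4: "kr V0 E 4 = 0" using V0.sum_codeg[of 3] by (simp add: cliques_induced kr_induced)
  have j1: "kr (V0 \<union> V1) E (Suc s) = kr V0 E (Suc s) + b * kr V0 E s" for s
    using kr_join_independent[of V0 V1 E s] fin disj(1) ind(1) join(1) card by simp
  have j2: "kr V E (Suc s) = kr (V0 \<union> V1) E (Suc s) + b * kr (V0 \<union> V1) E s" for s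
  proof -
    have "\<forall>x\<in>V0 \<union> V1. \<forall>y\<in>V2. {x, y} \<in> E" using join by blast
    moreover have "(V0 \<union> V1) \<inter> V2 = {}" using disj by blast
    ultimately show ?thesis
      using kr_join_independent[of "V0 \<union> V1" V2 E s] fin ind(2) unfolding V[symmetric] card by simp
  qed
  have j: "kr V E (Suc (Suc s)) = kr V0 E (Suc (Suc s)) + 2 * b * kr V0 E (Suc s) + b^2 * kr V0 E s" for s
    by (simp add: j2 j1 power2_eq_square algebra_simps)
  have k1: "kr V0 E (Suc 0) = b + r" using kr_1[of V0 E] card by simp
  have "kr V E 2 = kr V0 E 2 + 2 * b * (b + r) + b^2"
    using j[of 0] k1 fin by (simp add: kr_0 numeral_2_eq_2)
  then show "2 * kr V E 2 = (3*b+r) * (2*b+r)" using k2 by (simp add: power2_eq_square algebra_simps)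
  have "kr V E 3 = 2 * b * kr V0 E 2 + b^2 * (b + r)"
    using j[of 1] k1 tri by (simp add: numeral_2_eq_2 numeral_3_eq_3)
  also have "2 * b * kr V0 E 2 = b * ((b + r) * r)" unfolding k2[symmetric] by simp
  finally show "kr V E 3 = (b+r)^2 * b" by (simp add: power2_eq_square algebra_simps)
  have "kr V E 4 = b^2 * kr V0 E 2"
    using j[of 2] k4 tri by simp
  then have "2 * kr V E 4 = b^2 * (2 * kr V0 E 2)" by simp
  then show "2 * kr V E 4 = (b+r) * r * b^2" by (simp add: k2)
qed

section \<open>Transport of graphs along injective maps\<close>

lemma image_edge_iff:
  assumes "inj_on f U" "simple_graph U E" "x \<in> U" "y \<in> U"
  shows "{f x, f y} \<in> (`) f ` E \<longleftrightarrow> {x, y} \<in> E"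
proof
  assume "{f x, f y} \<in> (`) f ` E"
  then obtain e where e: "e \<in> E" "f ` {x, y} = f ` e" by auto
  moreover have "e \<subseteq> U" using e(1) assms(2) by (auto simp: simple_graph_def)
  ultimately have "{x, y} = e" using inj_on_image_eq_iff[OF assms(1), of "{x, y}" e] assms(3,4) by simp
  then show "{x, y} \<in> E" using e(1) by simp
next
  assume "{x, y} \<in> E"
  then show "{f x, f y} \<in> (`) f ` E" by (metis image_empty image_insert imageI)
qed

lemma simple_graph_image:
  assumes "inj_on f U" "simple_graph U E"
  shows "simple_graph (f ` U) ((`) f ` E)"
  unfolding simple_graph_def
proof (intro conjI ballI)
  show "finite (f ` U)" using assms(2) by (simp add: simple_graph_def)
  fix e assume "e \<in> (`) f ` E"
  then obtain e' where e': "e = f ` e'" "e' \<subseteq> U" "card e' = 2" using assms(2) by (auto simp: simple_graph_def)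
  then show "e \<subseteq> f ` U" by blast
  show "card e = 2" using e' card_image[OF inj_on_subset[OF assms(1) e'(2)]] by simp
qed

lemma regular_image:
  assumes "inj_on f U" "simple_graph U E" "regular U E d"
  shows "regular (f ` U) ((`) f ` E) d"
  unfolding regular_def
proof
  fix z assume "z \<in> f ` U"
  then obtain x where x: "x \<in> U" "z = f x" by auto
  have "{w \<in> f ` U. {z, w} \<in> (`) f ` E} = f ` {y\<in>U. {x, y} \<in> E}"
    using image_edge_iff[OF assms(1,2) x(1)] x(2) by auto
  moreover have "inj_on f {y\<in>U. {x, y} \<in> E}" using assms(1) by (rule inj_on_subset) auto
  ultimately have "degree (f ` U) ((`) f ` E) z = degree U E x"
    unfolding degree_def by (simp add: card_image)
  then show "degree (f ` U) ((`) f ` E) z = d" using assms(3) x(1) by (simp add: regular_def)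
qed

lemma kr_image:
  assumes inj: "inj_on f U" and E: "simple_graph U E"
  shows "kr (f ` U) ((`) f ` E) k = kr U E k"
proof -
  have card: "card (f ` L) = card L" if "L \<subseteq> U" for L
    using card_image inj_on_subset[OF inj that] by blast
  have cl: "f ` L \<in> cliques (f ` U) ((`) f ` E) k \<longleftrightarrow> L \<in> cliques U E k" if L: "L \<subseteq> U" for L
  proof -
    have eq: "(\<forall>x\<in>f ` L. \<forall>y\<in>f ` L. x \<noteq> y \<longrightarrow> {x, y} \<in> (`) f ` E) \<longleftrightarrow> (\<forall>x\<in>L. \<forall>y\<in>L. x \<noteq> y \<longrightarrow> {x, y} \<in> E)"
      using image_edge_iff[OF inj E] inj_on_eq_iff[OF inj] L
      by (simp add: subset_iff cong: ball_cong)
    show ?thesis by (simp only: cliques_def mem_Collect_eq eq card[OF L] L image_mono simp_thms)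
  qed
  have "cliques (f ` U) ((`) f ` E) k = (`) f ` cliques U E k"
  proof (intro equalityI subsetI)
    fix K assume K: "K \<in> cliques (f ` U) ((`) f ` E) k"
    then obtain L where L: "L \<subseteq> U" "K = f ` L" by (auto simp: cliques_def subset_image_iff)
    then show "K \<in> (`) f ` cliques U E k" using cl K by blast
  next
    fix K assume "K \<in> (`) f ` cliques U E k"
    then obtain L where "L \<in> cliques U E k" "K = f ` L" by auto
    then show "K \<in> cliques (f ` U) ((`) f ` E) k" using cl[of L] by (auto simp: cliques_def)
  qed
  moreover have "inj_on ((`) f) (cliques U E k)"
    by (rule inj_on_subset[OF inj_on_image_Pow[OF inj]]) (auto simp: cliques_def)
  ultimately show ?thesis by (simp add: kr_def card_image)
qed

text \<open>A competitor on the image pulls back along the inverse of \<open>f\<close>. Transport is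
  called for because \<open>feasible\<close> speaks of sets of naturals only.\<close>

lemma min_tri_regular_image:
  assumes inj: "inj_on f U" and m: "min_tri_regular U E d"
  shows "min_tri_regular (f ` U) ((`) f ` E) d"
proof -
  have E: "simple_graph U E" "regular U E d" using m by (auto simp: min_tri_regular_def)
  let ?g = "inv_into U f"
  have g: "inj_on ?g (f ` U)" "?g ` f ` U = U"
    using inj by (auto simp: inj_on_inv_into inv_into_image_cancel)
  have "kr (f ` U) ((`) f ` E) 3 \<le> kr (f ` U) E' 3" if E': "simple_graph (f ` U) E'" "regular (f ` U) E' d" for E'
  proof -
    have "simple_graph U ((`) ?g ` E')" "regular U ((`) ?g ` E') d"
      using simple_graph_image[OF g(1) E'(1)] regular_image[OF g(1) E'] g(2) by simp_all
    then have "kr U E 3 \<le> kr U ((`) ?g ` E') 3" using m by (simp add: min_tri_regular_def)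
    also have "\<dots> = kr (f ` U) E' 3" using kr_image[OF g(1) E'(1), of 3] g(2) by simp
    finally show ?thesis using kr_image[OF inj E(1)] by simp
  qed
  then show ?thesis
    using simple_graph_image[OF inj E(1)] regular_image[OF inj E] by (simp add: min_tri_regular_def)
qed

section \<open>Normalised clique counts and the equivalences\<close>

lemma frac_compare:
  fixes x y c d :: real
  assumes "c > 0" "d > 0"
  shows "x / c \<le> y / d \<longleftrightarrow> x * d \<le> y * c" "x / c = y / d \<longleftrightarrow> x * d = y * c"
  using assms by (simp_all add: divide_simps mult.commute)

theorem mainTheorem7:
  fixes V :: "'a set" and E :: "'a set set" and n :: nat and \<beta> :: real
  assumes "simple_graph V E" and "card V = n" and "n > 0"
    and "1/4 \<le> \<beta>" and "\<beta> < 1/3"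
    and "real (min_degree V E) = (1 - \<beta>) * n"
  shows "(\<forall>t s. 2 \<le> t \<and> t < s \<and> s \<le> 4 \<longrightarrow>
            kr V E s / (g_fun s \<beta> * n ^ s) \<ge> kr V E t / (g_fun t \<beta> * n ^ t))
    \<and> ((\<exists>t s. 2 \<le> t \<and> t < s \<and> s \<le> 4 \<and>
            kr V E s / (g_fun s \<beta> * n ^ s) = kr V E t / (g_fun t \<beta> * n ^ t))
        \<longleftrightarrow> (\<forall>t s. 2 \<le> t \<and> t < s \<and> s \<le> 4 \<longrightarrow>
            kr V E s / (g_fun s \<beta> * n ^ s) = kr V E t / (g_fun t \<beta> * n ^ t)))
    \<and> ((\<forall>t s. 2 \<le> t \<and> t < s \<and> s \<le> 4 \<longrightarrow>
            kr V E s / (g_fun s \<beta> * n ^ s) = kr V E t / (g_fun t \<beta> * n ^ t))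
        \<longleftrightarrow> feasible n \<beta> \<and> in_family V E n \<beta>)"
proof -
  define b where "b = n - min_degree V E"
  define r where "r = n - 3 * b"
  define h where "h t = kr V E t / (g_fun t \<beta> * n ^ t)" for t
  have md: "min_degree V E \<le> n"
  proof -
    have "(1 - \<beta>) * n \<le> 1 * real n" using assms(3,4) by (intro mult_right_mono) auto
    then show ?thesis using assms(6) by simp
  qed
  have bn: "\<beta> * n = b" using md assms(6) by (simp add: b_def of_nat_diff algebra_simps)
  have "3 * (\<beta> * n) < n"
    using mult_strict_right_mono[of "3 * \<beta>" 1 "real n"] assms(3,5) by simp
  then have "3 * b < n" unfolding bn by linarith
  then have r_pos: "0 < r" and n: "n = 3 * b + r" by (simp_all add: r_def)
  have "1 * real n \<le> (4 * \<beta>) * n" using assms(4) by (intro mult_right_mono) simp_all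
  then have "real n \<le> real (4 * b)" using bn by simp
  then have r_le: "r \<le> b" using n by linarith
  have b_pos: "b > 0" using r_pos r_le by simp
  interpret sgraph V E by unfold_locales (rule assms(1))
  have nd: "nd v \<le> b" if v: "v \<in> V" for v
  proof -
    have "min_degree V E \<le> degree V E v"
      unfolding min_degree_def using finite_V v by (intro Min_le) auto
    then show ?thesis using degree_plus_nd[of v] assms(2) by (simp add: b_def)
  qed
  interpret dense4_graph V E b r
    by unfold_locales (use nd assms(2) n r_pos r_le in auto)
  have h2: "h 2 = 2 * real (kr V E 2) / (real (3*b+r) * real (2*b+r))"
  proof -
    have "g_fun 2 \<beta> * real n ^ 2 = (n - \<beta> * n) * n / 2"
      by (simp add: g_fun_def power2_eq_square field_simps)
    then have g: "g_fun 2 \<beta> * real n ^ 2 = real (3*b+r) * real (2*b+r) / 2" unfolding bn by (simp add: n)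
    show ?thesis unfolding h_def of_nat_power g by simp
  qed
  have h3: "h 3 = real (kr V E 3) / (real (b+r) ^ 2 * real b)"
  proof -
    have "g_fun 3 \<beta> * real n ^ 3 = (n - 2 * (\<beta> * n))^2 * (\<beta> * n)"
      by (simp add: g_fun_def power2_eq_square power3_eq_cube algebra_simps)
    then have g: "g_fun 3 \<beta> * real n ^ 3 = real (b+r) ^ 2 * real b" unfolding bn by (simp add: n)
    show ?thesis unfolding h_def of_nat_power g by simp
  qed
  have h4: "h 4 = 2 * real (kr V E 4) / (real (b+r) * real r * real b ^ 2)"
  proof -
    have "g_fun 4 \<beta> * real n ^ 4 = (n - 2 * (\<beta> * n)) * (n - 3 * (\<beta> * n)) * (\<beta> * n)^2 / 2"
      by (simp add: g_fun_def power2_eq_square power4_eq_xxxx field_simps)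
    then have g: "g_fun 4 \<beta> * real n ^ 4 = real (b+r) * real r * real b ^ 2 / 2" unfolding bn by (simp add: n)
    show ?thesis unfolding h_def of_nat_power g by simp
  qed
  have pos: "real (3*b+r) * real (2*b+r) > 0" "real (b+r) ^ 2 * real b > 0" "real (b+r) * real r * real b ^ 2 > 0"
    "real (b+r) * real b > 0"
    using b_pos r_pos by simp_all
  have c32: "h 2 \<le> h 3 \<longleftrightarrow> 2 * b * (b+r)^2 * kr V E 2 \<le> (3*b+r) * (2*b+r) * kr V E 3"
    "h 2 = h 3 \<longleftrightarrow> 2 * b * (b+r)^2 * kr V E 2 = (3*b+r) * (2*b+r) * kr V E 3"
  proof -
    have "2 * real (kr V E 2) * (real (b+r) ^ 2 * real b) = real (2 * b * (b+r)^2 * kr V E 2)"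
      "real (kr V E 3) * (real (3*b+r) * real (2*b+r)) = real ((3*b+r) * (2*b+r) * kr V E 3)"
      by simp_all
    then show "h 2 \<le> h 3 \<longleftrightarrow> 2 * b * (b+r)^2 * kr V E 2 \<le> (3*b+r) * (2*b+r) * kr V E 3"
      "h 2 = h 3 \<longleftrightarrow> 2 * b * (b+r)^2 * kr V E 2 = (3*b+r) * (2*b+r) * kr V E 3"
      unfolding h2 h3 frac_compare[OF pos(1,2)] by (simp_all only: of_nat_le_iff of_nat_eq_iff)
  qed
  have c43: "h 3 \<le> h 4 \<longleftrightarrow> b * r * kr V E 3 \<le> 2 * (b + r) * kr V E 4"
    "h 3 = h 4 \<longleftrightarrow> b * r * kr V E 3 = 2 * (b + r) * kr V E 4"
  proof -
    \<comment> \<open>Both cross products share the positive factor \<open>(b+r) * b\<close>, which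
      cancels.\<close>
    have "real (kr V E 3) * (real (b+r) * real r * real b ^ 2) = real ((b+r) * b * (b * r * kr V E 3))"
      "2 * real (kr V E 4) * (real (b+r) ^ 2 * real b) = real ((b+r) * b * (2 * (b + r) * kr V E 4))"
      by (simp_all add: power2_eq_square)
    then show "h 3 \<le> h 4 \<longleftrightarrow> b * r * kr V E 3 \<le> 2 * (b + r) * kr V E 4"
      "h 3 = h 4 \<longleftrightarrow> b * r * kr V E 3 = 2 * (b + r) * kr V E 4"
      unfolding h3 h4 frac_compare[OF pos(2,3)] using b_pos
      by (simp_all only: of_nat_le_iff of_nat_eq_iff) simp_all
  qed
  have le: "h 2 \<le> h 3" "h 3 \<le> h 4"
    using c32(1) kr_3_ge c43(1) kr_4_ge by simp_all
  have eq32: "h 3 = h 4" if "h 2 = h 3"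
    using kr_4_eq c32(2) c43(2) that by simp
  have size0: "(1 - 2*\<beta>) * n = real (b + r)" and deg0: "(1 - 3*\<beta>) * n = real r"
    using bn n by (simp_all add: algebra_simps)
  have family: "feasible n \<beta> \<and> in_family V E n \<beta>" if "h 3 = h 4"
  proof -
    have "b * r * kr V E 3 = 2 * (b + r) * kr V E 4" using that c43(2) by simp
    from extremal_structure[OF this] obtain V0 V1 V2 where
      parts: "V0 \<union> V1 \<union> V2 = V" "V0 \<inter> V1 = {}" "V0 \<inter> V2 = {}" "V1 \<inter> V2 = {}"
        "card V0 = b + r" "card V1 = b" "card V2 = b"
      and edges: "\<forall>x\<in>V0. \<forall>y\<in>V1. {x, y} \<in> E" "\<forall>x\<in>V0. \<forall>y\<in>V2. {x, y} \<in> E"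
        "\<forall>x\<in>V1. \<forall>y\<in>V2. {x, y} \<in> E"
        "\<forall>x\<in>V1. \<forall>y\<in>V1. {x, y} \<notin> E" "\<forall>x\<in>V2. \<forall>y\<in>V2. {x, y} \<notin> E"
      and reg: "regular V0 (induced E V0) r" and tri: "kr V0 E 3 = 0" .
    have E0: "simple_graph V0 (induced E V0)"
      using simple_graph_induced[OF assms(1)] parts(1) by blast
    then have fin0: "finite V0" by (simp add: simple_graph_def)
    have "even ((b + r) * r)"
      using kr_extremal(1)[OF assms(1) parts edges reg tri] .
    \<comment> \<open>If \<open>3 * b + r\<close> and \<open>2 * b + r\<close> were both odd, then
      \<open>b\<close> would be even and \<open>r\<close> odd, making \<open>(b + r) * r\<close>
      odd.\<close>
    then have "\<not> (odd n \<and> odd (2 * b + r))" unfolding n by auto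
    moreover have "real (2 * b + r) = (1 - \<beta>) * n" using bn n by (simp add: algebra_simps)
    ultimately have fam: "family_defined n \<beta>"
      unfolding family_defined_def using assms(3) r_pos by (intro conjI exI[of _ "2 * b + r"]) auto
    have min_tri: "min_tri_regular V0 (induced E V0) r"
      unfolding min_tri_regular_def using E0 reg tri by (simp add: kr_induced)
    have "in_family V E n \<beta>"
      unfolding in_family_def
    proof (intro conjI exI)
      show "real (card V0) = (1 - 2*\<beta>) * n" "real (card V1) = \<beta> * n" "real (card V2) = \<beta> * n"
        "real r = (1 - 3*\<beta>) * n"
        using parts(5-7) size0 deg0 bn by simp_all
    qed (rule fam assms(1,2) parts edges min_tri)+
    moreover have "feasible n \<beta>"
      unfolding feasible_def
    proof (intro conjI fam allI impI, elim conjE)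
      fix U :: "nat set" and E' d
      assume U: "finite U" "real (card U) = (1 - 2*\<beta>) * n" "real d = (1 - 3*\<beta>) * n" "min_tri_regular U E' d"
      then have d: "d = r" and "card U = card V0" using size0 deg0 parts(5) by auto
      then obtain f where f: "bij_betw f V0 U" using finite_same_card_bij[OF fin0 U(1)] by auto
      then have inj: "inj_on f V0" and img: "f ` V0 = U" by (auto simp: bij_betw_def)
      \<comment> \<open>The copy on \<open>U\<close> of the graph on \<open>V0\<close> is a
        triangle-free competitor, so the minimum is 0.\<close>
      have "kr U E' 3 \<le> kr U ((`) f ` induced E V0) 3"
        using U(4) simple_graph_image[OF inj E0] regular_image[OF inj E0 reg]
        unfolding min_tri_regular_def d img by blast
      also have "\<dots> = 0" using kr_image[OF inj E0, of 3] tri unfolding img by (simp add: kr_induced)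
      finally show "kr U E' 3 = 0" by simp
    qed
    ultimately show ?thesis by simp
  qed
  have equality: "h 2 = h 3 \<and> h 3 = h 4" if F: "feasible n \<beta> \<and> in_family V E n \<beta>"
  proof -
    from F obtain V0 V1 V2 d where
      parts: "V0 \<union> V1 \<union> V2 = V" "V0 \<inter> V1 = {}" "V0 \<inter> V2 = {}" "V1 \<inter> V2 = {}"
      and card: "real (card V0) = (1 - 2*\<beta>) * n" "real (card V1) = \<beta> * n" "real (card V2) = \<beta> * n"
      and edges: "\<forall>x\<in>V0. \<forall>y\<in>V1. {x, y} \<in> E" "\<forall>x\<in>V0. \<forall>y\<in>V2. {x, y} \<in> E"
        "\<forall>x\<in>V1. \<forall>y\<in>V2. {x, y} \<in> E"
        "\<forall>x\<in>V1. \<forall>y\<in>V1. {x, y} \<notin> E" "\<forall>x\<in>V2. \<forall>y\<in>V2. {x, y} \<notin> E"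
      and d: "real d = (1 - 3*\<beta>) * n" and min: "min_tri_regular V0 (induced E V0) d"
      unfolding in_family_def by blast
    have dr: "d = r" using d deg0 by simp
    have cards: "card V0 = b + r" "card V1 = b" "card V2 = b"
      using card size0 bn by simp_all
    have E0: "simple_graph V0 (induced E V0)" and reg: "regular V0 (induced E V0) r"
      using min dr by (simp_all add: min_tri_regular_def)
    have fin0: "finite V0" using E0 by (simp add: simple_graph_def)
    \<comment> \<open>A copy on naturals brings the graph on \<open>V0\<close> into the scope of
      \<open>feasible\<close>.\<close>
    obtain f :: "'a \<Rightarrow> nat" where f: "inj_on f V0"
      using finite_imp_inj_to_nat_seg[OF fin0] by auto
    have "finite (f ` V0)" "real (card (f ` V0)) = (1 - 2*\<beta>) * n"
      using fin0 card(1) card_image[OF f] by simp_all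
    then have "kr (f ` V0) ((`) f ` induced E V0) 3 = 0"
      using conjunct2[OF F[THEN conjunct1, unfolded feasible_def], rule_format]
        min_tri_regular_image[OF f min] d by metis
    then have tri: "kr V0 E 3 = 0" using kr_image[OF f E0, of 3] by (simp add: kr_induced)
    note k = kr_extremal[OF assms(1) parts cards edges reg tri]
    have "2 * b * (b+r)^2 * kr V E 2 = b * (b+r)^2 * ((3*b+r) * (2*b+r))"
      unfolding k(2)[symmetric] by simp
    also have "\<dots> = (3*b+r) * (2*b+r) * kr V E 3" unfolding k(3) by simp
    finally have "h 2 = h 3" unfolding c32(2) .
    then show ?thesis using eq32 by simp
  qed
  have ts: "t = 2 \<and> s = 3 \<or> t = 2 \<and> s = 4 \<or> t = 3 \<and> s = 4" if "2 \<le> t \<and> t < s \<and> s \<le> 4" for t s :: nat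
    using that by auto
  have "\<forall>t s. 2 \<le> t \<and> t < s \<and> s \<le> 4 \<longrightarrow> h s \<ge> h t"
    using ts le order_trans[OF le] by metis
  moreover have all: "(\<forall>t s. 2 \<le> t \<and> t < s \<and> s \<le> 4 \<longrightarrow> h s = h t) \<longleftrightarrow> h 2 = h 3 \<and> h 3 = h 4"
  proof
    assume A: "\<forall>t s. 2 \<le> t \<and> t < s \<and> s \<le> 4 \<longrightarrow> h s = h t"
    have "h 3 = h 2" "h 4 = h 3" by (rule A[rule_format], simp)+
    then show "h 2 = h 3 \<and> h 3 = h 4" by metis
  next
    assume "h 2 = h 3 \<and> h 3 = h 4"
    then show "\<forall>t s. 2 \<le> t \<and> t < s \<and> s \<le> 4 \<longrightarrow> h s = h t"
      using ts by metis
  qed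
  moreover have "(\<exists>t s. 2 \<le> t \<and> t < s \<and> s \<le> 4 \<and> h s = h t) \<longleftrightarrow> h 2 = h 3 \<and> h 3 = h 4"
  proof
    assume "\<exists>t s. 2 \<le> t \<and> t < s \<and> s \<le> 4 \<and> h s = h t"
    then obtain t s where "2 \<le> t \<and> t < s \<and> s \<le> 4" "h s = h t" by blast
    then have "h 2 = h 3 \<or> h 2 = h 4 \<or> h 3 = h 4" using ts[of t s] by metis
    \<comment> \<open>Since \<open>h 2 \<le> h 3 \<le> h 4\<close>, equality of the outer two
      includes the middle one.\<close>
    then have "h 2 = h 3 \<or> h 3 = h 4" using le by linarith
    then show "h 2 = h 3 \<and> h 3 = h 4" using eq32 family equality by blast
  next
    assume "h 2 = h 3 \<and> h 3 = h 4"
    then have "h 3 = h 2" by metis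
    then show "\<exists>t s. 2 \<le> t \<and> t < s \<and> s \<le> 4 \<and> h s = h t"
      by (intro exI[of _ 2] exI[of _ 3]) simp
  qed
  moreover have "h 2 = h 3 \<and> h 3 = h 4 \<longleftrightarrow> feasible n \<beta> \<and> in_family V E n \<beta>"
    using family equality by blast
  ultimately have "(\<forall>t s. 2 \<le> t \<and> t < s \<and> s \<le> 4 \<longrightarrow> h s \<ge> h t)
    \<and> ((\<exists>t s. 2 \<le> t \<and> t < s \<and> s \<le> 4 \<and> h s = h t)
        \<longleftrightarrow> (\<forall>t s. 2 \<le> t \<and> t < s \<and> s \<le> 4 \<longrightarrow> h s = h t))
    \<and> ((\<forall>t s. 2 \<le> t \<and> t < s \<and> s \<le> 4 \<longrightarrow> h s = h t)
        \<longleftrightarrow> feasible n \<beta> \<and> in_family V E n \<beta>)"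
    by (simp only: simp_thms)
  then show ?thesis unfolding h_def .
qed

end
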